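(* Let $R$ be an integral domain and let $\pi$ be a prime element of $R$ satisfying $\bigcap_{n \geq 0}\pi^n R = \{0\}$. If $R/\pi R$ is not a Bezout domain, or if the canonical homomorphism $SL_2(R) \to SL_2(R/\pi R)$ is not surjective, then $SL_2(R[1/\pi]) \neq E_2(R[1/\pi])$.
   Context: A commutative ring is called Bezout if each of its finitely generated ideals is principal. For a commutative ring $S$, $E_2(S)$ denotes the subgroup of $SL_2(S)$ generated by all elementary matrices $\begin{pmatrix} 1 & r \\ 0 & 1 \end{pmatrix}$ and $\begin{pmatrix} 1 & 0 \\ r & 1 \end{pmatrix}$ with $r \in S$. $R[1/\pi]$ is the subring of the field of fractions of $R$ generated by $R$ and $1/\pi$. *)

theory Defs
  imports "HOL-Algebra.Algebra"
begin

locale bezout_ring = cring +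
  assumes finitely_generated_principal:
    "\<lbrakk> finite A; A \<subseteq> carrier R \<rbrakk> \<Longrightarrow> principalideal (Idl A) R"

locale bezout_domain = domain R + bezout_ring R for R (structure)


datatype 'a mat2 = Mat2 'a 'a 'a 'a

text \<open>\<open>Mat2 a b c d\<close> is the matrix with first row \<open>a, b\<close> and second row \<open>c, d\<close>.\<close>

fun mat2_mult :: "('a, 'm) ring_scheme \<Rightarrow> 'a mat2 \<Rightarrow> 'a mat2 \<Rightarrow> 'a mat2" where
  "mat2_mult S (Mat2 a b c d) (Mat2 a' b' c' d') =
     Mat2 (a \<otimes>\<^bsub>S\<^esub> a' \<oplus>\<^bsub>S\<^esub> b \<otimes>\<^bsub>S\<^esub> c') (a \<otimes>\<^bsub>S\<^esub> b' \<oplus>\<^bsub>S\<^esub> b \<otimes>\<^bsub>S\<^esub> d')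
          (c \<otimes>\<^bsub>S\<^esub> a' \<oplus>\<^bsub>S\<^esub> d \<otimes>\<^bsub>S\<^esub> c') (c \<otimes>\<^bsub>S\<^esub> b' \<oplus>\<^bsub>S\<^esub> d \<otimes>\<^bsub>S\<^esub> d')"

definition SL2 :: "('a, 'm) ring_scheme \<Rightarrow> 'a mat2 monoid" where
  "SL2 S =
     \<lparr> carrier = {Mat2 a b c d | a b c d.
         a \<in> carrier S \<and> b \<in> carrier S \<and> c \<in> carrier S \<and> d \<in> carrier S \<and>
         a \<otimes>\<^bsub>S\<^esub> d \<ominus>\<^bsub>S\<^esub> b \<otimes>\<^bsub>S\<^esub> c = \<one>\<^bsub>S\<^esub>},
       monoid.mult = mat2_mult S,
       monoid.one = Mat2 \<one>\<^bsub>S\<^esub> \<zero>\<^bsub>S\<^esub> \<zero>\<^bsub>S\<^esub> \<one>\<^bsub>S\<^esub> \<rparr>"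

definition E2 :: "('a, 'm) ring_scheme \<Rightarrow> 'a mat2 set" where
  "E2 S = generate (SL2 S)
     ({Mat2 \<one>\<^bsub>S\<^esub> r \<zero>\<^bsub>S\<^esub> \<one>\<^bsub>S\<^esub> | r. r \<in> carrier S} \<union> {Mat2 \<one>\<^bsub>S\<^esub> \<zero>\<^bsub>S\<^esub> r \<one>\<^bsub>S\<^esub> | r. r \<in> carrier S})"


text \<open>
  The field of fractions of a domain \<open>R\<close>: equivalence classes of pairs
  (numerator, nonzero denominator) under cross-multiplication.
\<close>

definition frac_rel :: "('a, 'm) ring_scheme \<Rightarrow> (('a \<times> 'a) \<times> ('a \<times> 'a)) set" where
  "frac_rel R = {((a, b), (c, d)) | a b c d.
     a \<in> carrier R \<and> b \<in> carrier R - {\<zero>\<^bsub>R\<^esub>} \<and> c \<in> carrier R \<and> d \<in> carrier R - {\<zero>\<^bsub>R\<^esub>} \<and>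
     a \<otimes>\<^bsub>R\<^esub> d = c \<otimes>\<^bsub>R\<^esub> b}"

definition fraction :: "('a, 'm) ring_scheme \<Rightarrow> 'a \<Rightarrow> 'a \<Rightarrow> ('a \<times> 'a) set" where
  "fraction R a b = frac_rel R `` {(a, b)}"

definition fraction_field :: "('a, 'm) ring_scheme \<Rightarrow> ('a \<times> 'a) set ring" where
  "fraction_field R =
     \<lparr> carrier = (carrier R \<times> (carrier R - {\<zero>\<^bsub>R\<^esub>})) // frac_rel R,
       monoid.mult = (\<lambda>x y. \<Union>(a, b)\<in>x. \<Union>(c, d)\<in>y. fraction R (a \<otimes>\<^bsub>R\<^esub> c) (b \<otimes>\<^bsub>R\<^esub> d)),
       monoid.one = fraction R \<one>\<^bsub>R\<^esub> \<one>\<^bsub>R\<^esub>,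
       ring.zero = fraction R \<zero>\<^bsub>R\<^esub> \<one>\<^bsub>R\<^esub>,
       ring.add = (\<lambda>x y. \<Union>(a, b)\<in>x. \<Union>(c, d)\<in>y.
                fraction R (a \<otimes>\<^bsub>R\<^esub> d \<oplus>\<^bsub>R\<^esub> c \<otimes>\<^bsub>R\<^esub> b) (b \<otimes>\<^bsub>R\<^esub> d)) \<rparr>"

definition frac_embed :: "('a, 'm) ring_scheme \<Rightarrow> 'a \<Rightarrow> ('a \<times> 'a) set" where
  "frac_embed R a = fraction R a \<one>\<^bsub>R\<^esub>"

text \<open>The ring \<open>R[1/p]\<close>, as a subring of the field of fractions.\<close>

definition adjoin_inverse :: "('a, 'm) ring_scheme \<Rightarrow> 'a \<Rightarrow> ('a \<times> 'a) set ring" where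
  "adjoin_inverse R p =
     (fraction_field R)
       \<lparr> carrier := generate_ring (fraction_field R)
           (frac_embed R ` carrier R \<union> {inv\<^bsub>fraction_field R\<^esub> (frac_embed R p)}) \<rparr>"


subsection \<open>The constructions yield a group and a field\<close>

lemma (in cring) SL2_is_group: "group (SL2 R)"
proof (rule groupI)
  fix x y assume "x \<in> carrier (SL2 R)" "y \<in> carrier (SL2 R)"
  then obtain a b c d a' b' c' d' where
    x: "x = Mat2 a b c d" "a \<in> carrier R" "b \<in> carrier R" "c \<in> carrier R" "d \<in> carrier R"
       "a \<otimes> d \<ominus> b \<otimes> c = \<one>" and
    y: "y = Mat2 a' b' c' d'" "a' \<in> carrier R" "b' \<in> carrier R" "c' \<in> carrier R" "d' \<in> carrier R"
       "a' \<otimes> d' \<ominus> b' \<otimes> c' = \<one>"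
    by (auto simp: SL2_def)
  have "(a \<otimes> a' \<oplus> b \<otimes> c') \<otimes> (c \<otimes> b' \<oplus> d \<otimes> d') \<ominus> (a \<otimes> b' \<oplus> b \<otimes> d') \<otimes> (c \<otimes> a' \<oplus> d \<otimes> c')
      = (a \<otimes> d \<ominus> b \<otimes> c) \<otimes> (a' \<otimes> d' \<ominus> b' \<otimes> c')"
    using x(2-5) y(2-5) by algebra
  also have "\<dots> = \<one>" using x(6) y(6) by simp
  finally show "x \<otimes>\<^bsub>SL2 R\<^esub> y \<in> carrier (SL2 R)"
    using x(1-5) y(1-5) by (simp add: SL2_def)
next
  show "\<one>\<^bsub>SL2 R\<^esub> \<in> carrier (SL2 R)"
    by (simp add: SL2_def) algebra
next
  fix x y z assume "x \<in> carrier (SL2 R)" "y \<in> carrier (SL2 R)" "z \<in> carrier (SL2 R)"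
  then show "x \<otimes>\<^bsub>SL2 R\<^esub> y \<otimes>\<^bsub>SL2 R\<^esub> z = x \<otimes>\<^bsub>SL2 R\<^esub> (y \<otimes>\<^bsub>SL2 R\<^esub> z)"
    by (auto simp: SL2_def l_distr r_distr m_assoc a_ac)
next
  fix x assume "x \<in> carrier (SL2 R)"
  then show "\<one>\<^bsub>SL2 R\<^esub> \<otimes>\<^bsub>SL2 R\<^esub> x = x"
    by (auto simp: SL2_def)
next
  fix x assume "x \<in> carrier (SL2 R)"
  then obtain a b c d where
    x: "x = Mat2 a b c d" "a \<in> carrier R" "b \<in> carrier R" "c \<in> carrier R" "d \<in> carrier R"
       "a \<otimes> d \<ominus> b \<otimes> c = \<one>"
    by (auto simp: SL2_def)
  show "\<exists>y\<in>carrier (SL2 R). y \<otimes>\<^bsub>SL2 R\<^esub> x = \<one>\<^bsub>SL2 R\<^esub>"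
  proof
    have "d \<otimes> a \<ominus> (\<ominus> b) \<otimes> (\<ominus> c) = a \<otimes> d \<ominus> b \<otimes> c"
         "d \<otimes> a \<oplus> (\<ominus> b) \<otimes> c = a \<otimes> d \<ominus> b \<otimes> c"
         "d \<otimes> b \<oplus> (\<ominus> b) \<otimes> d = \<zero>"
         "(\<ominus> c) \<otimes> a \<oplus> a \<otimes> c = \<zero>"
         "(\<ominus> c) \<otimes> b \<oplus> a \<otimes> d = a \<otimes> d \<ominus> b \<otimes> c"
      using x(2-5) by algebra+
    note * = this[unfolded x(6)]
    from * x(2-5) show "Mat2 d (\<ominus> b) (\<ominus> c) a \<in> carrier (SL2 R)"
      by (simp add: SL2_def)
    from * show "Mat2 d (\<ominus> b) (\<ominus> c) a \<otimes>\<^bsub>SL2 R\<^esub> x = \<one>\<^bsub>SL2 R\<^esub>"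
      by (simp add: SL2_def x(1))
  qed
qed

lemma (in cring) E2_is_subgroup: "subgroup (E2 R) (SL2 R)"
proof -
  have "r \<in> carrier R \<Longrightarrow> \<one> \<otimes> \<one> \<ominus> r \<otimes> \<zero> = \<one>"
       "r \<in> carrier R \<Longrightarrow> \<one> \<otimes> \<one> \<ominus> \<zero> \<otimes> r = \<one>" for r
    by (simp_all add: minus_eq)
  then show ?thesis unfolding E2_def
    by (intro group.generate_is_subgroup[OF SL2_is_group]) (auto simp: SL2_def)
qed

context domain
begin

lemma frac_rel_equiv: "equiv (carrier R \<times> (carrier R - {\<zero>})) (frac_rel R)"
proof (rule equivI)
  show "frac_rel R \<subseteq> (carrier R \<times> (carrier R - {\<zero>})) \<times> (carrier R \<times> (carrier R - {\<zero>}))"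
    by (auto simp: frac_rel_def)
  show "refl_on (carrier R \<times> (carrier R - {\<zero>})) (frac_rel R)"
    by (auto simp: frac_rel_def refl_on_def)
  show "sym (frac_rel R)"
    by (auto simp: frac_rel_def sym_def)
  show "trans (frac_rel R)"
  proof (rule transI, clarsimp simp: frac_rel_def)
    fix a b c d e f
    assume car: "a \<in> carrier R" "b \<in> carrier R" "c \<in> carrier R" "d \<in> carrier R"
        "e \<in> carrier R" "f \<in> carrier R"
      and d: "d \<noteq> \<zero>" and eq: "a \<otimes> d = c \<otimes> b" "c \<otimes> f = e \<otimes> d"
    have "d \<otimes> (a \<otimes> f) = (a \<otimes> d) \<otimes> f" using car by algebra
    also have "\<dots> = (c \<otimes> f) \<otimes> b" unfolding eq(1) using car by algebra
    also have "\<dots> = d \<otimes> (e \<otimes> b)" unfolding eq(2) using car by algebra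
    finally show "a \<otimes> f = e \<otimes> b" using car d m_lcancel by auto
  qed
qed

lemma frac_eq_iff:
  assumes "a \<in> carrier R" "b \<in> carrier R - {\<zero>}" "c \<in> carrier R" "d \<in> carrier R - {\<zero>}"
  shows "fraction R a b = fraction R c d \<longleftrightarrow> a \<otimes> d = c \<otimes> b"
  unfolding fraction_def using assms
  by (subst eq_equiv_class_iff[OF frac_rel_equiv]) (auto simp: frac_rel_def)

lemma frac_closed:
  assumes "a \<in> carrier R" "b \<in> carrier R - {\<zero>}"
  shows "fraction R a b \<in> carrier (fraction_field R)"
  using assms by (auto simp: fraction_field_def fraction_def intro!: quotientI)

lemma fracE:
  assumes "x \<in> carrier (fraction_field R)"
  obtains a b where "a \<in> carrier R" "b \<in> carrier R" "b \<noteq> \<zero>" "x = fraction R a b"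
  using assms by (auto simp: fraction_field_def fraction_def elim!: quotientE)

lemma nonzero_mult:
  assumes "a \<in> carrier R - {\<zero>}" "b \<in> carrier R - {\<zero>}"
  shows "a \<otimes> b \<in> carrier R - {\<zero>}"
  using assms integral by auto

lemma frac_mult:
  assumes "a \<in> carrier R" "b \<in> carrier R - {\<zero>}" "c \<in> carrier R" "d \<in> carrier R - {\<zero>}"
  shows "fraction R a b \<otimes>\<^bsub>fraction_field R\<^esub> fraction R c d = fraction R (a \<otimes> c) (b \<otimes> d)"
proof -
  let ?f = "\<lambda>p q. case p of (a, b) \<Rightarrow> (case q of (c, d) \<Rightarrow> fraction R (a \<otimes> c) (b \<otimes> d))"
  have "congruent2 (frac_rel R) (frac_rel R) ?f"
  proof (rule congruent2I', clarify)
    fix a b a' b' c d c' d'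
    assume "((a, b), (a', b')) \<in> frac_rel R" "((c, d), (c', d')) \<in> frac_rel R"
    then have car: "a \<in> carrier R" "b \<in> carrier R - {\<zero>}" "a' \<in> carrier R" "b' \<in> carrier R - {\<zero>}"
        "c \<in> carrier R" "d \<in> carrier R - {\<zero>}" "c' \<in> carrier R" "d' \<in> carrier R - {\<zero>}"
      and eq: "a \<otimes> b' = a' \<otimes> b" "c \<otimes> d' = c' \<otimes> d"
      by (auto simp: frac_rel_def)
    have car': "b \<in> carrier R" "b' \<in> carrier R" "d \<in> carrier R" "d' \<in> carrier R" using car by auto
    have "(a \<otimes> c) \<otimes> (b' \<otimes> d') = (a \<otimes> b') \<otimes> (c \<otimes> d')" using car car' by algebra
    also have "\<dots> = (a' \<otimes> c') \<otimes> (b \<otimes> d)" unfolding eq using car car' by algebra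
    finally show "fraction R (a \<otimes> c) (b \<otimes> d) = fraction R (a' \<otimes> c') (b' \<otimes> d')"
      using car by (subst frac_eq_iff) (auto intro!: nonzero_mult simp del: Diff_iff)
  qed
  from UN_equiv_class2[OF frac_rel_equiv frac_rel_equiv this, of "(a, b)" "(c, d)"] assms
  show ?thesis by (simp add: fraction_field_def fraction_def case_prod_unfold)
qed

lemma frac_add:
  assumes "a \<in> carrier R" "b \<in> carrier R - {\<zero>}" "c \<in> carrier R" "d \<in> carrier R - {\<zero>}"
  shows "fraction R a b \<oplus>\<^bsub>fraction_field R\<^esub> fraction R c d = fraction R (a \<otimes> d \<oplus> c \<otimes> b) (b \<otimes> d)"
proof -
  let ?f = "\<lambda>p q. case p of (a, b) \<Rightarrow> (case q of (c, d) \<Rightarrow> fraction R (a \<otimes> d \<oplus> c \<otimes> b) (b \<otimes> d))"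
  have "congruent2 (frac_rel R) (frac_rel R) ?f"
  proof (rule congruent2I', clarify)
    fix a b a' b' c d c' d'
    assume "((a, b), (a', b')) \<in> frac_rel R" "((c, d), (c', d')) \<in> frac_rel R"
    then have car: "a \<in> carrier R" "b \<in> carrier R - {\<zero>}" "a' \<in> carrier R" "b' \<in> carrier R - {\<zero>}"
        "c \<in> carrier R" "d \<in> carrier R - {\<zero>}" "c' \<in> carrier R" "d' \<in> carrier R - {\<zero>}"
      and eq: "a \<otimes> b' = a' \<otimes> b" "c \<otimes> d' = c' \<otimes> d"
      by (auto simp: frac_rel_def)
    have car': "b \<in> carrier R" "b' \<in> carrier R" "d \<in> carrier R" "d' \<in> carrier R" using car by auto
    have "(a \<otimes> d \<oplus> c \<otimes> b) \<otimes> (b' \<otimes> d') = (a \<otimes> b') \<otimes> (d \<otimes> d') \<oplus> (c \<otimes> d') \<otimes> (b \<otimes> b')"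
      using car car' by algebra
    also have "\<dots> = (a' \<otimes> d' \<oplus> c' \<otimes> b') \<otimes> (b \<otimes> d)" unfolding eq using car car' by algebra
    finally show "fraction R (a \<otimes> d \<oplus> c \<otimes> b) (b \<otimes> d) = fraction R (a' \<otimes> d' \<oplus> c' \<otimes> b') (b' \<otimes> d')"
      using car car' by (subst frac_eq_iff) (auto intro!: nonzero_mult simp del: Diff_iff)
  qed
  from UN_equiv_class2[OF frac_rel_equiv frac_rel_equiv this, of "(a, b)" "(c, d)"] assms
  show ?thesis by (simp add: fraction_field_def fraction_def case_prod_unfold)
qed

lemma frac_zero: "\<zero>\<^bsub>fraction_field R\<^esub> = fraction R \<zero> \<one>"
  and frac_one: "\<one>\<^bsub>fraction_field R\<^esub> = fraction R \<one> \<one>"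
  by (simp_all add: fraction_field_def)

lemma fraction_field_is_field: "field (fraction_field R)"
proof -
  let ?K = "fraction_field R"
  note nz = integral_iff
  have cr: "cring ?K"
  proof (rule cringI)
    show "abelian_group ?K"
    proof (rule abelian_groupI)
      fix x y assume "x \<in> carrier ?K" "y \<in> carrier ?K"
      then show "x \<oplus>\<^bsub>?K\<^esub> y \<in> carrier ?K"
        by (elim fracE) (simp add: frac_add frac_closed nz)
    next
      show "\<zero>\<^bsub>?K\<^esub> \<in> carrier ?K" by (simp add: frac_zero frac_closed)
    next
      fix x y z assume "x \<in> carrier ?K" "y \<in> carrier ?K" "z \<in> carrier ?K"
      then show "x \<oplus>\<^bsub>?K\<^esub> y \<oplus>\<^bsub>?K\<^esub> z = x \<oplus>\<^bsub>?K\<^esub> (y \<oplus>\<^bsub>?K\<^esub> z)"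
        by (elim fracE) (simp add: frac_add frac_eq_iff nz, algebra)
    next
      fix x y assume "x \<in> carrier ?K" "y \<in> carrier ?K"
      then show "x \<oplus>\<^bsub>?K\<^esub> y = y \<oplus>\<^bsub>?K\<^esub> x"
        by (elim fracE) (simp add: frac_add frac_eq_iff nz, algebra)
    next
      fix x assume "x \<in> carrier ?K"
      then show "\<zero>\<^bsub>?K\<^esub> \<oplus>\<^bsub>?K\<^esub> x = x"
        by (elim fracE) (simp add: frac_zero frac_add frac_eq_iff nz)
    next
      fix x assume "x \<in> carrier ?K"
      then obtain a b where x: "a \<in> carrier R" "b \<in> carrier R" "b \<noteq> \<zero>" "x = fraction R a b"
        by (elim fracE)
      have "fraction R (\<ominus> a) b \<oplus>\<^bsub>?K\<^esub> x = \<zero>\<^bsub>?K\<^esub>"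
        using x by (simp add: frac_zero frac_add frac_eq_iff nz l_minus l_neg)
      then show "\<exists>y\<in>carrier ?K. y \<oplus>\<^bsub>?K\<^esub> x = \<zero>\<^bsub>?K\<^esub>"
        using x by (intro bexI[of _ "fraction R (\<ominus> a) b"]) (auto intro: frac_closed)
    qed
    show "Group.comm_monoid ?K"
    proof (rule comm_monoidI)
      fix x y assume "x \<in> carrier ?K" "y \<in> carrier ?K"
      then show "x \<otimes>\<^bsub>?K\<^esub> y \<in> carrier ?K"
        by (elim fracE) (simp add: frac_mult frac_closed nz)
    next
      show "\<one>\<^bsub>?K\<^esub> \<in> carrier ?K" by (simp add: frac_one frac_closed)
    next
      fix x y z assume "x \<in> carrier ?K" "y \<in> carrier ?K" "z \<in> carrier ?K"
      then show "x \<otimes>\<^bsub>?K\<^esub> y \<otimes>\<^bsub>?K\<^esub> z = x \<otimes>\<^bsub>?K\<^esub> (y \<otimes>\<^bsub>?K\<^esub> z)"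
        by (elim fracE) (simp add: frac_mult frac_eq_iff nz m_assoc)
    next
      fix x assume "x \<in> carrier ?K"
      then show "\<one>\<^bsub>?K\<^esub> \<otimes>\<^bsub>?K\<^esub> x = x"
        by (elim fracE) (simp add: frac_one frac_mult)
    next
      fix x y assume "x \<in> carrier ?K" "y \<in> carrier ?K"
      then show "x \<otimes>\<^bsub>?K\<^esub> y = y \<otimes>\<^bsub>?K\<^esub> x"
        by (elim fracE) (simp add: frac_mult frac_eq_iff nz m_comm)
    qed
    fix x y z assume "x \<in> carrier ?K" "y \<in> carrier ?K" "z \<in> carrier ?K"
    then show "(x \<oplus>\<^bsub>?K\<^esub> y) \<otimes>\<^bsub>?K\<^esub> z = x \<otimes>\<^bsub>?K\<^esub> z \<oplus>\<^bsub>?K\<^esub> y \<otimes>\<^bsub>?K\<^esub> z"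
      by (elim fracE) (simp add: frac_mult frac_add frac_eq_iff nz, algebra)
  qed
  show ?thesis
  proof (rule cring.cring_fieldI2[OF cr])
    show "\<zero>\<^bsub>?K\<^esub> \<noteq> \<one>\<^bsub>?K\<^esub>" by (simp add: frac_zero frac_one frac_eq_iff)
  next
    fix x assume "x \<in> carrier ?K" "x \<noteq> \<zero>\<^bsub>?K\<^esub>"
    then obtain a b where x: "a \<in> carrier R" "b \<in> carrier R" "b \<noteq> \<zero>" "x = fraction R a b" "a \<noteq> \<zero>"
      by (elim fracE) (auto simp: frac_zero frac_eq_iff)
    then have "x \<otimes>\<^bsub>?K\<^esub> fraction R b a = \<one>\<^bsub>?K\<^esub>"
      by (simp add: frac_mult frac_one frac_eq_iff nz m_comm)
    then show "\<exists>y\<in>carrier ?K. x \<otimes>\<^bsub>?K\<^esub> y = \<one>\<^bsub>?K\<^esub>"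
      using x by (intro bexI[of _ "fraction R b a"]) (auto intro: frac_closed)
  qed
qed

lemma frac_embed_hom: "ring_hom_ring R (fraction_field R) (frac_embed R)"
proof (rule ring_hom_ringI2)
  show "ring R" by (rule ring_axioms)
  show "ring (fraction_field R)"
    using fraction_field_is_field by (simp add: field_def domain_def cring_def)
  show "frac_embed R \<in> ring_hom R (fraction_field R)"
    by (rule ring_hom_memI)
       (simp_all add: frac_embed_def frac_closed frac_mult frac_add frac_one)
qed

lemma frac_embed_inj: "inj_on (frac_embed R) (carrier R)"
  by (rule inj_onI) (simp add: frac_embed_def frac_eq_iff)

end

end

theory Submission
  imports Defs
begin

text \<open>
  Write \<open>A = R[1/\<pi>]\<close>. The group \<open>E\<^sub>2(A)\<close> is contained in the subgroup generated by \<open>SL\<^sub>2(R)\<close> and its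
  conjugate by \<open>diag(1, \<pi>)\<close>; these are the stabilizers of two adjacent vertices
  in the tree of \<open>SL\<^sub>2\<close>. Multiplying out an alternating word in the two groups shows that every element
  of \<open>E\<^sub>2(A)\<close> outside \<open>SL\<^sub>2(R)\<close> becomes, after clearing the power of \<open>\<pi>\<close> in the denominator and reducing
  modulo \<open>\<pi>\<close>, a nonzero matrix whose columns are multiples of the first column of an element of
  \<open>SL\<^sub>2(R)\<close>. If \<open>SL\<^sub>2(A) = E\<^sub>2(A)\<close>, applying this to a unipotent matrix that fixes \<open>(a, b)\<close> shows that
  \<open>SL\<^sub>2(R)\<close> acts transitively on the lines spanned by vectors over \<open>R/\<pi>R\<close>. Hence every nonzero \<open>(a, b)\<close> over \<open>R/\<pi>R\<close>
  is a multiple \<open>l \<cdot> (e, c)\<close> of a unimodular vector, so that \<open>l\<close> generates the ideal \<open>(a, b)\<close>; and a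
  matrix in \<open>SL\<^sub>2(R/\<pi>R)\<close> is a liftable matrix times an upper triangular one, which is elementary.
\<close>

section \<open>Words in two subgroups\<close>

locale two_subgroups = group G for G (structure) +
  fixes H\<^sub>0 H\<^sub>1
  assumes H\<^sub>0: "subgroup H\<^sub>0 G" and H\<^sub>1: "subgroup H\<^sub>1 G"
begin

text \<open>Reduced words as in an amalgamated product: letters outside
  \<open>H\<^sub>0 \<inter> H\<^sub>1\<close> alternate, the first lies in \<open>H\<^sub>1\<close>,
  and only the last letter, from \<open>H\<^sub>0\<close>, is unrestricted. A leading factor from
  \<open>H\<^sub>0\<close> is added in \<open>normal_forms\<close>.\<close>

inductive_set alternating :: "'a set" where
  base: "\<lbrakk> k \<in> H\<^sub>1 - H\<^sub>0; h \<in> H\<^sub>0 \<rbrakk> \<Longrightarrow> k \<otimes> h \<in> alternating"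
| step: "\<lbrakk> k \<in> H\<^sub>1 - H\<^sub>0; h \<in> H\<^sub>0 - H\<^sub>1; w \<in> alternating \<rbrakk> \<Longrightarrow> k \<otimes> h \<otimes> w \<in> alternating"

definition normal_forms :: "'a set" where
  "normal_forms = H\<^sub>0 \<union> {h \<otimes> w | h w. h \<in> H\<^sub>0 \<and> w \<in> alternating}"

lemma H\<^sub>0_carrier: "h \<in> H\<^sub>0 \<Longrightarrow> h \<in> carrier G"
  using subgroup.subset[OF H\<^sub>0] by blast

lemma H\<^sub>1_carrier: "h \<in> H\<^sub>1 \<Longrightarrow> h \<in> carrier G"
  using subgroup.subset[OF H\<^sub>1] by blast

lemma alternating_carrier: "w \<in> alternating \<Longrightarrow> w \<in> carrier G"
  by (induction rule: alternating.induct) (auto simp: H\<^sub>0_carrier H\<^sub>1_carrier)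

lemma normal_forms_carrier: "g \<in> normal_forms \<Longrightarrow> g \<in> carrier G"
  by (auto simp: normal_forms_def H\<^sub>0_carrier alternating_carrier)

lemma normal_forms_H\<^sub>0_mult:
  assumes "h \<in> H\<^sub>0" "g \<in> normal_forms"
  shows "h \<otimes> g \<in> normal_forms"
proof (cases "g \<in> H\<^sub>0")
  case True
  then show ?thesis
    using assms subgroup.m_closed[OF H\<^sub>0] unfolding normal_forms_def by blast
next
  case False
  then obtain h' w where g: "g = h' \<otimes> w" "h' \<in> H\<^sub>0" "w \<in> alternating"
    using assms unfolding normal_forms_def by blast
  then have "h \<otimes> g = (h \<otimes> h') \<otimes> w"
    using assms by (simp add: m_assoc H\<^sub>0_carrier alternating_carrier)
  then show ?thesis
    using assms g subgroup.m_closed[OF H\<^sub>0] unfolding normal_forms_def by blast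
qed

lemma alternating_subset_normal_forms: "alternating \<subseteq> normal_forms"
proof
  fix w assume w: "w \<in> alternating"
  then have "w = \<one> \<otimes> w" by (simp add: alternating_carrier)
  with w show "w \<in> normal_forms"
    unfolding normal_forms_def using subgroup.one_closed[OF H\<^sub>0] by blast
qed

text \<open>The new letter merges with the first letter of the word. If the product falls into
  \<open>H\<^sub>0\<close>, it joins the next letter as a leading \<open>H\<^sub>0\<close> factor;
  otherwise the word keeps its shape.\<close>

lemma normal_forms_H\<^sub>1_mult_alternating:
  assumes "k \<in> H\<^sub>1" "w \<in> alternating"
  shows "k \<otimes> w \<in> normal_forms"
  using assms(2)
proof cases
  case (base k' h)
  note car = H\<^sub>1_carrier[OF assms(1)] H\<^sub>1_carrier[of k'] H\<^sub>0_carrier[OF base(3)]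
  have kk: "k \<otimes> k' \<in> H\<^sub>1" using subgroup.m_closed[OF H\<^sub>1 assms(1)] base by blast
  have eq: "k \<otimes> w = (k \<otimes> k') \<otimes> h" using base car by (simp add: m_assoc)
  show ?thesis
  proof (cases "k \<otimes> k' \<in> H\<^sub>0")
    case True
    then show ?thesis unfolding eq normal_forms_def
      using base subgroup.m_closed[OF H\<^sub>0] by blast
  next
    case False
    then show ?thesis unfolding eq
      using alternating.base kk base(3) alternating_subset_normal_forms by blast
  qed
next
  case (step k' h w')
  note car = H\<^sub>1_carrier[OF assms(1)] H\<^sub>1_carrier[of k'] H\<^sub>0_carrier[of h] alternating_carrier[OF step(4)]
  have kk: "k \<otimes> k' \<in> H\<^sub>1" using subgroup.m_closed[OF H\<^sub>1 assms(1)] step by blast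
  have eq: "k \<otimes> w = (k \<otimes> k') \<otimes> h \<otimes> w'" using step car by (simp add: m_assoc)
  show ?thesis
  proof (cases "k \<otimes> k' \<in> H\<^sub>0")
    case True
    then have "k \<otimes> k' \<otimes> h \<in> H\<^sub>0" using step subgroup.m_closed[OF H\<^sub>0] by blast
    then show ?thesis unfolding eq normal_forms_def using step by blast
  next
    case False
    then show ?thesis unfolding eq
      using alternating.step kk step alternating_subset_normal_forms by blast
  qed
qed

text \<open>For \<open>k\<close> outside \<open>H\<^sub>0\<close>, a leading factor \<open>h\<close>
  in \<open>H\<^sub>1\<close> is absorbed into \<open>k\<close>; otherwise \<open>k\<close> and
  \<open>h\<close> are two legitimate new letters in front of the word.\<close>

lemma normal_forms_H\<^sub>1_mult:
  assumes k: "k \<in> H\<^sub>1" and g: "g \<in> normal_forms"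
  shows "k \<otimes> g \<in> normal_forms"
proof (cases "k \<in> H\<^sub>0")
  case True
  then show ?thesis using g normal_forms_H\<^sub>0_mult by blast
next
  case False
  consider "g \<in> H\<^sub>0" | h w where "g = h \<otimes> w" "h \<in> H\<^sub>0" "w \<in> alternating"
    using g unfolding normal_forms_def by blast
  then show ?thesis
  proof cases
    case 1
    then show ?thesis
      using alternating.base False k alternating_subset_normal_forms by blast
  next
    case 2
    have eq: "k \<otimes> g = k \<otimes> h \<otimes> w"
      using 2 k by (simp add: m_assoc H\<^sub>0_carrier H\<^sub>1_carrier alternating_carrier)
    show ?thesis
    proof (cases "h \<in> H\<^sub>1")
      case True
      then have "k \<otimes> h \<in> H\<^sub>1" using k subgroup.m_closed[OF H\<^sub>1] by blast
      then show ?thesis unfolding eq using 2 normal_forms_H\<^sub>1_mult_alternating by blast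
    next
      case h: False
      then show ?thesis unfolding eq
        using alternating.step False k 2 alternating_subset_normal_forms by blast
    qed
  qed
qed

lemma generate_subset_normal_forms: "generate G (H\<^sub>0 \<union> H\<^sub>1) \<subseteq> normal_forms"
proof
  fix g assume "g \<in> generate G (H\<^sub>0 \<union> H\<^sub>1)"
  \<comment> \<open>Stability under left multiplication passes to products of generated elements,
    unlike bare membership; applied to \<open>\<one>\<close> it yields membership.\<close>
  then have "g \<in> carrier G \<and> (\<forall>x\<in>normal_forms. g \<otimes> x \<in> normal_forms)"
  proof (induction rule: generate.induct)
    case one
    then show ?case by (simp add: normal_forms_carrier)
  next
    case (incl h)
    then show ?case
      using normal_forms_H\<^sub>0_mult normal_forms_H\<^sub>1_mult H\<^sub>0_carrier H\<^sub>1_carrier by blast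
  next
    case (inv h)
    then have "inv h \<in> H\<^sub>0 \<union> H\<^sub>1"
      using subgroup.m_inv_closed[OF H\<^sub>0] subgroup.m_inv_closed[OF H\<^sub>1] by blast
    then show ?case
      using normal_forms_H\<^sub>0_mult normal_forms_H\<^sub>1_mult H\<^sub>0_carrier H\<^sub>1_carrier by blast
  next
    case (eng g h)
    then show ?case by (simp add: m_assoc normal_forms_carrier)
  qed
  moreover have "\<one> \<in> normal_forms"
    unfolding normal_forms_def using subgroup.one_closed[OF H\<^sub>0] by blast
  ultimately show "g \<in> normal_forms" by force
qed

end

section \<open>Elementary matrices\<close>

context cring
begin

lemma mem_SL2:
  "Mat2 a b c d \<in> carrier (SL2 R) \<longleftrightarrow>
     a \<in> carrier R \<and> b \<in> carrier R \<and> c \<in> carrier R \<and> d \<in> carrier R \<and> a \<otimes> d \<ominus> b \<otimes> c = \<one>"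
  by (simp add: SL2_def)

lemma SL2_mult: "x \<otimes>\<^bsub>SL2 R\<^esub> y = mat2_mult R x y"
  by (simp add: SL2_def)

lemma SL2_one: "\<one>\<^bsub>SL2 R\<^esub> = Mat2 \<one> \<zero> \<zero> \<one>"
  by (simp add: SL2_def)

lemma SL2_inv:
  assumes "Mat2 a b c d \<in> carrier (SL2 R)"
  shows "inv\<^bsub>SL2 R\<^esub> (Mat2 a b c d) = Mat2 d (\<ominus> b) (\<ominus> c) a"
proof -
  interpret G: group "SL2 R" by (rule SL2_is_group)
  have car: "a \<in> carrier R" "b \<in> carrier R" "c \<in> carrier R" "d \<in> carrier R"
    and det: "a \<otimes> d \<ominus> b \<otimes> c = \<one>"
    using assms by (auto simp: mem_SL2)
  have *: "d \<otimes> a \<ominus> (\<ominus> b) \<otimes> (\<ominus> c) = a \<otimes> d \<ominus> b \<otimes> c"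
       "d \<otimes> a \<oplus> (\<ominus> b) \<otimes> c = a \<otimes> d \<ominus> b \<otimes> c"
       "d \<otimes> b \<oplus> (\<ominus> b) \<otimes> d = \<zero>"
       "(\<ominus> c) \<otimes> a \<oplus> a \<otimes> c = \<zero>"
       "(\<ominus> c) \<otimes> b \<oplus> a \<otimes> d = a \<otimes> d \<ominus> b \<otimes> c"
    using car by algebra+
  note * = this[unfolded det]
  show ?thesis
    by (rule G.inv_equality) (use * car assms in \<open>auto simp: mem_SL2 SL2_mult SL2_one\<close>)
qed

lemma upper_mem_SL2: "r \<in> carrier R \<Longrightarrow> Mat2 \<one> r \<zero> \<one> \<in> carrier (SL2 R)"
  and lower_mem_SL2: "r \<in> carrier R \<Longrightarrow> Mat2 \<one> \<zero> r \<one> \<in> carrier (SL2 R)"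
  by (simp_all add: mem_SL2 minus_eq)

end

section \<open>Inverting a prime element\<close>

text \<open>Here \<open>R\<close> is the localized ring and \<open>S\<close> the original ring
  inside it. Divisibility by \<open>p\<close> in \<open>S\<close> becomes membership of
  \<open>u \<otimes> a\<close> in \<open>S\<close>: \<open>u_notin\<close> says that
  \<open>p\<close> is no unit of \<open>S\<close>, and \<open>prime\<close> that products behave as
  for a prime element.\<close>

locale prime_localization = cring R for R (structure) +
  fixes S p u
  assumes S: "subring S R"
    and p: "p \<in> S" and u: "u \<in> carrier R" and pu: "p \<otimes> u = \<one>"
    and u_notin: "u \<notin> S"
    and prime: "\<lbrakk> a \<in> S; b \<in> S; u \<otimes> (a \<otimes> b) \<in> S \<rbrakk> \<Longrightarrow> u \<otimes> a \<in> S \<or> u \<otimes> b \<in> S"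
    and fractions: "a \<in> carrier R \<Longrightarrow> \<exists>s\<in>S. \<exists>n::nat. a = s \<otimes> u [^] n"
begin

lemma S_carrier [simp]: "a \<in> S \<Longrightarrow> a \<in> carrier R"
  using subringE(1)[OF S] by blast

lemmas S_zero [simp] = subringE(2)[OF S]
  and S_one [simp] = subringE(3)[OF S]
  and S_neg [simp] = subringE(5)[OF S]
  and S_mult [simp] = subringE(6)[OF S]
  and S_add [simp] = subringE(7)[OF S]

declare p [simp] u [simp]

lemma S_minus [simp]: "a \<in> S \<Longrightarrow> b \<in> S \<Longrightarrow> a \<ominus> b \<in> S"
  by (simp add: minus_eq)

lemma p_u_cancel [simp]: "a \<in> carrier R \<Longrightarrow> p \<otimes> (u \<otimes> a) = a"
  "a \<in> carrier R \<Longrightarrow> u \<otimes> (p \<otimes> a) = a"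
  using pu by (simp_all add: m_assoc[symmetric] m_comm[of u p])

text \<open>For \<open>x \<in> S\<close>, the condition \<open>u \<otimes> x \<in> S\<close> says that \<open>p\<close> divides \<open>x\<close> in \<open>S\<close>. The subgroups
  \<open>stab0\<close> and \<open>stab1\<close> are the stabilizers of two adjacent vertices in the tree of \<open>SL\<^sub>2\<close>.\<close>

definition stab0 :: "'a mat2 set" where
  "stab0 = {Mat2 a b c d | a b c d. Mat2 a b c d \<in> carrier (SL2 R) \<and> a \<in> S \<and> b \<in> S \<and> c \<in> S \<and> d \<in> S}"

definition stab1 :: "'a mat2 set" where
  "stab1 = {Mat2 a b c d | a b c d.
     Mat2 a b c d \<in> carrier (SL2 R) \<and> a \<in> S \<and> p \<otimes> b \<in> S \<and> u \<otimes> c \<in> S \<and> d \<in> S}"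

lemma mem_stab0: "Mat2 a b c d \<in> stab0 \<longleftrightarrow>
     Mat2 a b c d \<in> carrier (SL2 R) \<and> a \<in> S \<and> b \<in> S \<and> c \<in> S \<and> d \<in> S"
  by (auto simp: stab0_def)

lemma mem_stab1: "Mat2 a b c d \<in> stab1 \<longleftrightarrow>
     Mat2 a b c d \<in> carrier (SL2 R) \<and> a \<in> S \<and> p \<otimes> b \<in> S \<and> u \<otimes> c \<in> S \<and> d \<in> S"
  by (auto simp: stab1_def)

section \<open>The two vertex stabilizers and the elementary matrices\<close>

lemma stab0_subgroup: "subgroup stab0 (SL2 R)"
proof -
  interpret G: group "SL2 R" by (rule SL2_is_group)
  show ?thesis
  proof (rule G.subgroupI)
    show "stab0 \<subseteq> carrier (SL2 R)" by (auto simp: stab0_def)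
    have "\<one>\<^bsub>SL2 R\<^esub> \<in> stab0"
      unfolding SL2_one mem_stab0 by (simp add: upper_mem_SL2)
    then show "stab0 \<noteq> {}" by blast
  next
    fix x assume "x \<in> stab0"
    moreover from this have "inv\<^bsub>SL2 R\<^esub> x \<in> carrier (SL2 R)" by (auto simp: stab0_def)
    ultimately show "inv\<^bsub>SL2 R\<^esub> x \<in> stab0"
      by (cases x) (auto simp: mem_stab0 SL2_inv)
  next
    fix x y assume "x \<in> stab0" "y \<in> stab0"
    moreover from this have "x \<otimes>\<^bsub>SL2 R\<^esub> y \<in> carrier (SL2 R)" by (auto simp: stab0_def)
    ultimately show "x \<otimes>\<^bsub>SL2 R\<^esub> y \<in> stab0"
      by (cases x; cases y) (auto simp: mem_stab0 SL2_mult)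
  qed
qed

lemma stab1_subgroup: "subgroup stab1 (SL2 R)"
proof -
  interpret G: group "SL2 R" by (rule SL2_is_group)
  show ?thesis
  proof (rule G.subgroupI)
    show "stab1 \<subseteq> carrier (SL2 R)" by (auto simp: stab1_def)
    have "\<one>\<^bsub>SL2 R\<^esub> \<in> stab1"
      unfolding SL2_one mem_stab1 by (simp add: upper_mem_SL2)
    then show "stab1 \<noteq> {}" by blast
  next
    fix x assume "x \<in> stab1"
    moreover from this have "inv\<^bsub>SL2 R\<^esub> x \<in> carrier (SL2 R)" by (auto simp: stab1_def)
    ultimately show "inv\<^bsub>SL2 R\<^esub> x \<in> stab1"
      by (cases x) (auto simp: mem_stab1 SL2_inv mem_SL2 r_minus)
  next
    fix x y assume xy: "x \<in> stab1" "y \<in> stab1"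
    then have car: "x \<otimes>\<^bsub>SL2 R\<^esub> y \<in> carrier (SL2 R)" by (auto simp: stab1_def)
    obtain a b c d a' b' c' d' where [simp]: "x = Mat2 a b c d" "y = Mat2 a' b' c' d'"
      by (cases x, cases y) auto
    have C: "a \<in> S" "p \<otimes> b \<in> S" "u \<otimes> c \<in> S" "d \<in> S" "b \<in> carrier R" "c \<in> carrier R"
      "a' \<in> S" "p \<otimes> b' \<in> S" "u \<otimes> c' \<in> S" "d' \<in> S" "b' \<in> carrier R" "c' \<in> carrier R"
      using xy by (auto simp: mem_stab1 mem_SL2)
    have car': "p \<in> carrier R" "u \<in> carrier R" "a \<in> carrier R" "b \<in> carrier R" "c \<in> carrier R" "d \<in> carrier R"
      "a' \<in> carrier R" "b' \<in> carrier R" "c' \<in> carrier R" "d' \<in> carrier R"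
      using C by auto
    \<comment> \<open>An upper right entry may carry a denominator \<open>p\<close>, while a lower
      left entry is divisible by \<open>p\<close>; moving the factor \<open>p\<close> across puts
      their product into \<open>S\<close>.\<close>
    have swap: "x \<otimes> y = (p \<otimes> x) \<otimes> (u \<otimes> y)" if "x \<in> carrier R" "y \<in> carrier R" for x y
    proof -
      have "(p \<otimes> x) \<otimes> (u \<otimes> y) = (p \<otimes> u) \<otimes> (x \<otimes> y)" using that p[THEN S_carrier] u by algebra
      then show ?thesis using that pu by simp
    qed
    have 1: "a \<otimes> a' \<oplus> b \<otimes> c' \<in> S"
      using C by (simp add: swap[of b c'])
    have 2: "p \<otimes> (a \<otimes> b' \<oplus> b \<otimes> d') = a \<otimes> (p \<otimes> b') \<oplus> (p \<otimes> b) \<otimes> d'"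
      using car' by algebra
    have 3: "u \<otimes> (c \<otimes> a' \<oplus> d \<otimes> c') = (u \<otimes> c) \<otimes> a' \<oplus> d \<otimes> (u \<otimes> c')"
      using car' by algebra
    have 4: "c \<otimes> b' \<oplus> d \<otimes> d' \<in> S"
      using C by (simp add: m_comm[of c b'] swap[of b' c])
    show "x \<otimes>\<^bsub>SL2 R\<^esub> y \<in> stab1"
      using car 1 2 3 4 C by (simp add: SL2_mult mem_stab1)
  qed
qed

text \<open>\<open>Mat2 u \<zero> \<zero> p\<close> is the product of an antidiagonal element of
  \<open>stab1\<close> and one of \<open>stab0\<close>. Conjugating upper elementary matrices by it,
  and lower ones by its inverse, multiplies the off-diagonal entry by \<open>u\<close> twice, so
  elementary matrices over \<open>S\<close> spread to all of \<open>R\<close>.\<close>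

lemma E2_subset_generate: "E2 R \<subseteq> generate (SL2 R) (stab0 \<union> stab1)"
proof -
  interpret G: group "SL2 R" by (rule SL2_is_group)
  let ?H = "generate (SL2 R) (stab0 \<union> stab1)"
  have sub: "stab0 \<union> stab1 \<subseteq> carrier (SL2 R)"
    by (auto simp: stab0_def stab1_def)
  have H: "subgroup ?H (SL2 R)" by (rule G.generate_is_subgroup[OF sub])
  have pc [simp]: "p \<in> carrier R" by simp
  have up: "u \<otimes> p = \<one>" using pu by (simp add: m_comm)
  have "Mat2 \<zero> (\<ominus> u) p \<zero> \<in> stab1" "Mat2 \<zero> \<one> (\<ominus> \<one>) \<zero> \<in> stab0"
    by (simp_all add: mem_stab1 mem_stab0 mem_SL2 minus_eq l_minus r_minus up pu)
  then have "mat2_mult R (Mat2 \<zero> (\<ominus> u) p \<zero>) (Mat2 \<zero> \<one> (\<ominus> \<one>) \<zero>) \<in> ?H"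
    unfolding SL2_mult[symmetric] by (intro generate.eng generate.incl) auto
  then have diag: "Mat2 u \<zero> \<zero> p \<in> ?H" by (simp add: l_minus r_minus)
  moreover have "Mat2 u \<zero> \<zero> p \<in> carrier (SL2 R)" by (simp add: mem_SL2 minus_eq up)
  ultimately have diag': "Mat2 p \<zero> \<zero> u \<in> ?H"
    using subgroup.m_inv_closed[OF H diag] by (simp add: SL2_inv)
  note Hm = subgroup.m_closed[OF H, unfolded SL2_mult]
  have ind: "Mat2 \<one> (s \<otimes> u [^] (2 * n)) \<zero> \<one> \<in> ?H \<and> Mat2 \<one> \<zero> (s \<otimes> u [^] (2 * n)) \<one> \<in> ?H"
    if s: "s \<in> S" for s and n :: nat
  proof (induction n)
    case 0
    have "Mat2 \<one> s \<zero> \<one> \<in> stab0" "Mat2 \<one> \<zero> s \<one> \<in> stab0"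
      using s by (simp_all add: mem_stab0 upper_mem_SL2 lower_mem_SL2)
    then show ?case using s by (auto intro: generate.incl)
  next
    case (Suc n)
    define a where "a = s \<otimes> u [^] (2 * n)"
    have a: "a \<in> carrier R" using s by (simp add: a_def)
    have eq: "u \<otimes> (u \<otimes> a) = s \<otimes> u [^] (2 * Suc n)"
      using s by (simp add: a_def m_ac)
    have *: "mat2_mult R (mat2_mult R (Mat2 u \<zero> \<zero> p) (Mat2 \<one> a \<zero> \<one>)) (Mat2 p \<zero> \<zero> u) \<in> ?H"
      "mat2_mult R (mat2_mult R (Mat2 p \<zero> \<zero> u) (Mat2 \<one> \<zero> a \<one>)) (Mat2 u \<zero> \<zero> p) \<in> ?H"
      using Suc diag diag' unfolding a_def by (intro Hm; simp)+
    show ?case unfolding eq[symmetric]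
      using * a by (simp add: pu up m_comm[of _ u] m_assoc)
  qed
  have "Mat2 \<one> a \<zero> \<one> \<in> ?H \<and> Mat2 \<one> \<zero> a \<one> \<in> ?H" if a: "a \<in> carrier R" for a
  proof -
    obtain s and n :: nat where s: "s \<in> S" "a = s \<otimes> u [^] n"
      using fractions[OF a] by blast
    \<comment> \<open>Conjugation produces only even powers of \<open>u\<close>; the exponent
      \<open>n\<close> is raised to \<open>2 * n\<close> by moving \<open>p [^] n\<close> into the
      numerator.\<close>
    have "p [^] n \<in> S" by (induction n) simp_all
    moreover have "p [^] n \<otimes> u [^] (2 * n) = u [^] n"
    proof -
      have "p [^] n \<otimes> u [^] n = \<one>" by (simp add: pu nat_pow_distrib[symmetric])
      then show ?thesis
        by (simp add: mult_2 nat_pow_mult[symmetric] m_assoc[symmetric])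
    qed
    then have "a = (s \<otimes> p [^] n) \<otimes> u [^] (2 * n)" using s by (simp add: m_assoc)
    ultimately show ?thesis using ind[of "s \<otimes> p [^] n" n] s(1) by simp
  qed
  then show ?thesis
    unfolding E2_def by (intro G.generate_subgroup_incl[OF _ H]) auto
qed

section \<open>Alternating words in the two stabilizers, reduced modulo \<open>p\<close>\<close>

interpretation SL2: two_subgroups "SL2 R" stab0 stab1
  by (intro two_subgroups.intro two_subgroups_axioms.intro SL2_is_group stab0_subgroup stab1_subgroup)

lemma prime_not: "a \<in> S \<Longrightarrow> b \<in> S \<Longrightarrow> u \<otimes> a \<notin> S \<Longrightarrow> u \<otimes> b \<notin> S \<Longrightarrow> u \<otimes> (a \<otimes> b) \<notin> S"
  using prime by blast

lemma dvd_add_cancel: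
  assumes "a \<in> carrier R" "b \<in> carrier R" "u \<otimes> a \<in> S"
  shows "u \<otimes> (a \<oplus> b) \<in> S \<longleftrightarrow> u \<otimes> b \<in> S" "u \<otimes> (b \<oplus> a) \<in> S \<longleftrightarrow> u \<otimes> b \<in> S"
proof -
  have "u \<otimes> b = u \<otimes> (a \<oplus> b) \<ominus> u \<otimes> a" "u \<otimes> (a \<oplus> b) = u \<otimes> a \<oplus> u \<otimes> b"
    using assms(1,2) u by algebra+
  then show *: "u \<otimes> (a \<oplus> b) \<in> S \<longleftrightarrow> u \<otimes> b \<in> S" using assms(3) S_minus S_add by metis
  show "u \<otimes> (b \<oplus> a) \<in> S \<longleftrightarrow> u \<otimes> b \<in> S" using * assms by (simp add: a_comm)
qed

lemma dvd_mult_right: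
  assumes "a \<in> S" "b \<in> carrier R" "u \<otimes> b \<in> S"
  shows "u \<otimes> (a \<otimes> b) \<in> S"
proof -
  have "u \<otimes> (a \<otimes> b) = a \<otimes> (u \<otimes> b)" using assms(1)[THEN S_carrier] assms(2) u by algebra
  then show ?thesis using assms by simp
qed

lemma dvd_mult_left:
  assumes "a \<in> S" "b \<in> carrier R" "u \<otimes> b \<in> S"
  shows "u \<otimes> (b \<otimes> a) \<in> S"
  using dvd_mult_right[OF assms] assms by (simp add: m_comm)

text \<open>Up to a power of \<open>u\<close>, an alternating word is a matrix over \<open>S\<close> whose reduction modulo \<open>p\<close>
  has vanishing second row and nonzero first row.\<close>

definition first_row :: "nat \<Rightarrow> 'a mat2 \<Rightarrow> bool" where
  "first_row m g \<longleftrightarrow> (\<exists>x y z t. g = Mat2 (u [^] m \<otimes> x) (u [^] m \<otimes> y) (u [^] m \<otimes> z) (u [^] m \<otimes> t) \<and>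
     x \<in> S \<and> y \<in> S \<and> z \<in> S \<and> t \<in> S \<and> u \<otimes> z \<in> S \<and> u \<otimes> t \<in> S \<and> (u \<otimes> x \<notin> S \<or> u \<otimes> y \<notin> S))"

text \<open>Pulling out one more factor \<open>u\<close> turns \<open>k\<close> into a matrix over
  \<open>S\<close> whose only entry surviving modulo \<open>p\<close> is the upper right one,
  \<open>b\<close>. It moves the second row, nonzero modulo \<open>p\<close> by \<open>zt\<close>,
  into the first; primality keeps the result nonzero.\<close>

lemma first_row_stab1_mult:
  assumes k: "k \<in> stab1 - stab0"
    and S: "x \<in> S" "y \<in> S" "z \<in> S" "t \<in> S" and zt: "u \<otimes> z \<notin> S \<or> u \<otimes> t \<notin> S"
  shows "first_row (Suc m) (mat2_mult R k (Mat2 (u [^] m \<otimes> x) (u [^] m \<otimes> y) (u [^] m \<otimes> z) (u [^] m \<otimes> t)))"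
proof -
  obtain a b' c' d where k_eq: "k = Mat2 a b' c' d" by (cases k) auto
  define b where "b = p \<otimes> b'"
  define c where "c = u \<otimes> c'"
  have k': "a \<in> S" "b \<in> S" "c \<in> S" "d \<in> S" "b' \<in> carrier R" "c' \<in> carrier R"
    "Mat2 a b' c' d \<in> carrier (SL2 R)"
    using k unfolding k_eq by (auto simp: mem_stab1 mem_SL2 b_def c_def)
  have b': "b' = u \<otimes> b" and c': "c' = p \<otimes> c"
    using k'(5,6) by (simp_all add: b_def c_def)
  \<comment> \<open>The lower left entry of an element of \<open>stab1\<close> lies in
    \<open>S\<close> anyway, so only the upper right entry can keep \<open>k\<close> out of
    \<open>stab0\<close>.\<close>
  have "b' \<notin> S"
  proof
    assume "b' \<in> S"
    moreover have "c' \<in> S" using k' by (simp add: c')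
    ultimately have "k \<in> stab0" using k' by (simp add: mem_stab0 k_eq)
    with k show False by simp
  qed
  then have ub: "u \<otimes> b \<notin> S" by (simp add: b')
  have car: "a \<in> carrier R" "b \<in> carrier R" "c \<in> carrier R" "d \<in> carrier R"
    "x \<in> carrier R" "y \<in> carrier R" "z \<in> carrier R" "t \<in> carrier R"
    "p \<in> carrier R" "u \<in> carrier R" "u [^] m \<in> carrier R"
    using k' S by simp_all
  have top: "a \<otimes> (u [^] m \<otimes> v) \<oplus> b' \<otimes> (u [^] m \<otimes> w) = u [^] Suc m \<otimes> (p \<otimes> (a \<otimes> v) \<oplus> b \<otimes> w)"
    if "v \<in> carrier R" "w \<in> carrier R" for v w
  proof -
    have "u [^] Suc m \<otimes> (p \<otimes> (a \<otimes> v) \<oplus> b \<otimes> w)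
        = (p \<otimes> u) \<otimes> (u [^] m \<otimes> (a \<otimes> v)) \<oplus> (u \<otimes> b) \<otimes> (u [^] m \<otimes> w)"
      using car that unfolding nat_pow_Suc by algebra
    also have "\<dots> = a \<otimes> (u [^] m \<otimes> v) \<oplus> b' \<otimes> (u [^] m \<otimes> w)"
      using car that by (simp add: pu b' m_lcomm)
    finally show ?thesis by simp
  qed
  have bot: "c' \<otimes> (u [^] m \<otimes> v) \<oplus> d \<otimes> (u [^] m \<otimes> w) = u [^] Suc m \<otimes> (p \<otimes> (p \<otimes> (c \<otimes> v) \<oplus> d \<otimes> w))"
    if "v \<in> carrier R" "w \<in> carrier R" for v w
  proof -
    have "u [^] Suc m \<otimes> (p \<otimes> (p \<otimes> (c \<otimes> v) \<oplus> d \<otimes> w))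
        = (p \<otimes> u) \<otimes> (u [^] m \<otimes> (p \<otimes> (c \<otimes> v) \<oplus> d \<otimes> w))"
      using car that unfolding nat_pow_Suc by algebra
    also have "\<dots> = (p \<otimes> c) \<otimes> (u [^] m \<otimes> v) \<oplus> d \<otimes> (u [^] m \<otimes> w)"
      unfolding pu using car that by algebra
    finally show ?thesis by (simp add: c')
  qed
  have nz: "u \<otimes> (p \<otimes> (a \<otimes> v) \<oplus> b \<otimes> w) \<notin> S" if "v \<in> S" "w \<in> S" "u \<otimes> w \<notin> S" for v w
    using that k' ub by (simp add: dvd_add_cancel prime_not)
  show ?thesis
    unfolding first_row_def k_eq
    by (intro exI[of _ "p \<otimes> (a \<otimes> x) \<oplus> b \<otimes> z"] exI[of _ "p \<otimes> (a \<otimes> y) \<oplus> b \<otimes> t"]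
          exI[of _ "p \<otimes> (p \<otimes> (c \<otimes> x) \<oplus> d \<otimes> z)"] exI[of _ "p \<otimes> (p \<otimes> (c \<otimes> y) \<oplus> d \<otimes> t)"])
       (use S k' zt nz top bot in \<open>auto\<close>)
qed

text \<open>A letter from \<open>stab0 - stab1\<close> has a lower left entry not divisible by
  \<open>p\<close> and carries a nonzero first row into the second; the next letter from
  \<open>stab1 - stab0\<close> carries it back at the cost of a factor \<open>u\<close>. Every word
  has a letter of the latter kind, hence the exponent \<open>Suc m\<close>.\<close>

lemma alternating_first_row:
  assumes "w \<in> SL2.alternating"
  shows "\<exists>m. first_row (Suc m) w"
  using assms
proof (induction rule: SL2.alternating.induct)
  case (base k h)
  obtain e f g i where h: "h = Mat2 e f g i" by (cases h) auto
  have S: "e \<in> S" "f \<in> S" "g \<in> S" "i \<in> S" and det: "e \<otimes> i \<ominus> f \<otimes> g = \<one>"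
    using base by (auto simp: h mem_stab0 mem_SL2)
  \<comment> \<open>If \<open>p\<close> divided the whole second row, it would divide the
    determinant \<open>\<one>\<close>, and \<open>u\<close> would lie in \<open>S\<close>.\<close>
  have "u \<otimes> g \<notin> S \<or> u \<otimes> i \<notin> S"
  proof (rule ccontr)
    assume "\<not> (u \<otimes> g \<notin> S \<or> u \<otimes> i \<notin> S)"
    then have "e \<otimes> (u \<otimes> i) \<ominus> f \<otimes> (u \<otimes> g) \<in> S" using S by simp
    moreover have "e \<otimes> (u \<otimes> i) \<ominus> f \<otimes> (u \<otimes> g) = u \<otimes> (e \<otimes> i \<ominus> f \<otimes> g)"
      using S[THEN S_carrier] u by algebra
    ultimately show False using det u_notin by simp
  qed
  then have "first_row (Suc 0) (mat2_mult R k (Mat2 (u [^] (0::nat) \<otimes> e) (u [^] (0::nat) \<otimes> f)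
      (u [^] (0::nat) \<otimes> g) (u [^] (0::nat) \<otimes> i)))"
    by (intro first_row_stab1_mult base S)
  then show ?case using S by (auto simp: h SL2_mult)
next
  case (step k h w)
  then obtain m where "first_row (Suc m) w" by blast
  then obtain x y z t where w: "w = Mat2 (u [^] Suc m \<otimes> x) (u [^] Suc m \<otimes> y) (u [^] Suc m \<otimes> z) (u [^] Suc m \<otimes> t)"
    and xS: "x \<in> S" "y \<in> S" "z \<in> S" "t \<in> S" and zt: "u \<otimes> z \<in> S" "u \<otimes> t \<in> S"
    and xy: "u \<otimes> x \<notin> S \<or> u \<otimes> y \<notin> S"
    unfolding first_row_def by blast
  define q where "q = u [^] Suc m"
  have q: "q \<in> carrier R" by (simp add: q_def)
  obtain e f g i where h: "h = Mat2 e f g i" by (cases h) auto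
  have S: "e \<in> S" "f \<in> S" "g \<in> S" "i \<in> S" and car: "h \<in> carrier (SL2 R)"
    using step(2) by (auto simp: h mem_stab0 mem_SL2)
  have "u \<otimes> g \<notin> S"
    using step(2) by (auto simp: h mem_stab0 mem_stab1)
  \<comment> \<open>Modulo \<open>p\<close> the second row of \<open>h\<close> times
    \<open>w\<close> is \<open>g\<close> times \<open>(x, y)\<close>, because \<open>z\<close> and
    \<open>t\<close> vanish.\<close>
  then have "u \<otimes> (g \<otimes> x \<oplus> i \<otimes> z) \<notin> S \<or> u \<otimes> (g \<otimes> y \<oplus> i \<otimes> t) \<notin> S"
    using xy zt S xS by (auto simp: dvd_add_cancel dvd_mult_right prime_not)
  then have "first_row (Suc (Suc m)) (mat2_mult R k (Mat2 (q \<otimes> (e \<otimes> x \<oplus> f \<otimes> z)) (q \<otimes> (e \<otimes> y \<oplus> f \<otimes> t))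
      (q \<otimes> (g \<otimes> x \<oplus> i \<otimes> z)) (q \<otimes> (g \<otimes> y \<oplus> i \<otimes> t))))"
    unfolding q_def by (intro first_row_stab1_mult step) (use S xS in auto)
  also have "Mat2 (q \<otimes> (e \<otimes> x \<oplus> f \<otimes> z)) (q \<otimes> (e \<otimes> y \<oplus> f \<otimes> t))
      (q \<otimes> (g \<otimes> x \<oplus> i \<otimes> z)) (q \<otimes> (g \<otimes> y \<oplus> i \<otimes> t)) = mat2_mult R h w"
    using S[THEN S_carrier] xS[THEN S_carrier] q
    unfolding h w q_def[symmetric] by (simp add: r_distr m_lcomm)
  also have "mat2_mult R k (mat2_mult R h w) = k \<otimes>\<^bsub>SL2 R\<^esub> h \<otimes>\<^bsub>SL2 R\<^esub> w"
    unfolding SL2_mult[symmetric]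
    using SL2.m_assoc car step SL2.alternating_carrier SL2.H\<^sub>1_carrier by simp
  finally show ?case by blast
qed

text \<open>The element of \<open>SL\<^sub>2\<close> used here is a unipotent matrix fixing the vector \<open>(a, b)\<close>; modulo \<open>p\<close>,
  the columns of \<open>p\<close> times this matrix are multiples of \<open>(a, b)\<close>. Comparing with the normal form
  makes \<open>(a, b)\<close> proportional to the first column of a matrix in \<open>stab0\<close>.\<close>

lemma column_lift:
  assumes E2: "carrier (SL2 R) = E2 R"
    and ab: "a \<in> S" "b \<in> S" "u \<otimes> a \<notin> S \<or> u \<otimes> b \<notin> S"
  shows "\<exists>e f c i. Mat2 e f c i \<in> stab0 \<and> u \<otimes> (a \<otimes> c \<ominus> b \<otimes> e) \<in> S"
proof -
  define g where "g = Mat2 (\<one> \<ominus> u \<otimes> (a \<otimes> b)) (u \<otimes> (a \<otimes> a)) (\<ominus> (u \<otimes> (b \<otimes> b))) (\<one> \<oplus> u \<otimes> (a \<otimes> b))"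
  have car: "a \<in> carrier R" "b \<in> carrier R" "u \<in> carrier R" "p \<in> carrier R"
    using ab by simp_all
  have "(\<one> \<ominus> u \<otimes> (a \<otimes> b)) \<otimes> (\<one> \<oplus> u \<otimes> (a \<otimes> b)) \<ominus> (u \<otimes> (a \<otimes> a)) \<otimes> (\<ominus> (u \<otimes> (b \<otimes> b))) = \<one>"
    using car by algebra
  then have "g \<in> carrier (SL2 R)" using car by (simp add: g_def mem_SL2)
  then have "g \<in> SL2.normal_forms"
    using E2 E2_subset_generate SL2.generate_subset_normal_forms by blast
  then consider "g \<in> stab0" | h w where "g = h \<otimes>\<^bsub>SL2 R\<^esub> w" "h \<in> stab0" "w \<in> SL2.alternating"
    unfolding SL2.normal_forms_def by blast
  then show ?thesis
  proof cases
    case 1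
    \<comment> \<open>If \<open>g\<close> had no denominators, \<open>p\<close> would divide both
      squares and hence both \<open>a\<close> and \<open>b\<close>.\<close>
    then have "u \<otimes> (a \<otimes> a) \<in> S" "\<ominus> (\<ominus> (u \<otimes> (b \<otimes> b))) \<in> S"
      unfolding g_def mem_stab0 using S_neg by blast+
    then have "u \<otimes> a \<in> S" "u \<otimes> b \<in> S" using prime ab car by auto
    with ab show ?thesis by blast
  next
    case 2
    obtain m where "first_row (Suc m) w" using alternating_first_row 2 by blast
    then obtain x y z t where w: "w = Mat2 (u [^] Suc m \<otimes> x) (u [^] Suc m \<otimes> y) (u [^] Suc m \<otimes> z) (u [^] Suc m \<otimes> t)"
      and xS: "x \<in> S" "y \<in> S" "z \<in> S" "t \<in> S" and zt: "u \<otimes> z \<in> S" "u \<otimes> t \<in> S"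
      and xy: "u \<otimes> x \<notin> S \<or> u \<otimes> y \<notin> S"
      unfolding first_row_def by blast
    obtain e f c i where h: "h = Mat2 e f c i" by (cases h) auto
    have hS: "e \<in> S" "f \<in> S" "c \<in> S" "i \<in> S"
      using 2 by (auto simp: h mem_stab0)
    define q where "q = u [^] Suc m"
    \<comment> \<open>Of the \<open>Suc m\<close> factors \<open>p\<close> that cancel
      \<open>q\<close>, one clears the denominators of \<open>g\<close>; \<open>P\<close> collects
      the remaining \<open>m\<close>.\<close>
    define P where "P = p [^] m"
    have PS: "P \<in> S" unfolding P_def by (induction m) simp_all
    have q: "q \<in> carrier R" by (simp add: q_def)
    have Ppq: "(P \<otimes> p) \<otimes> q = \<one>"
    proof -
      have "(P \<otimes> p) \<otimes> q = p [^] Suc m \<otimes> u [^] Suc m" by (simp add: P_def q_def)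
      also have "\<dots> = (p \<otimes> u) [^] Suc m" by (rule nat_pow_distrib[symmetric]) simp_all
      finally show ?thesis by (simp add: pu)
    qed
    note car2 = hS[THEN S_carrier] xS[THEN S_carrier] PS[THEN S_carrier] q
    have "g = Mat2 (q \<otimes> (e \<otimes> x \<oplus> f \<otimes> z)) (q \<otimes> (e \<otimes> y \<oplus> f \<otimes> t))
        (q \<otimes> (c \<otimes> x \<oplus> i \<otimes> z)) (q \<otimes> (c \<otimes> y \<oplus> i \<otimes> t))"
      unfolding 2(1) h w q_def[symmetric] SL2_mult
      using car2 by (simp add: r_distr m_lcomm)
    then have eqs: "\<one> \<ominus> u \<otimes> (a \<otimes> b) = q \<otimes> (e \<otimes> x \<oplus> f \<otimes> z)"
      "u \<otimes> (a \<otimes> a) = q \<otimes> (e \<otimes> y \<oplus> f \<otimes> t)"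
      "\<ominus> (u \<otimes> (b \<otimes> b)) = q \<otimes> (c \<otimes> x \<oplus> i \<otimes> z)"
      "\<one> \<oplus> u \<otimes> (a \<otimes> b) = q \<otimes> (c \<otimes> y \<oplus> i \<otimes> t)"
      by (simp_all add: g_def)
    have scale: "v = P \<otimes> (p \<otimes> v')" if "v' = q \<otimes> v" "v \<in> carrier R" for v v'
    proof -
      have "P \<otimes> (p \<otimes> v') = ((P \<otimes> p) \<otimes> q) \<otimes> v" using that car2 car by (simp add: m_assoc)
      then show ?thesis using that by (simp add: Ppq)
    qed
    have X1: "e \<otimes> x \<oplus> f \<otimes> z = P \<otimes> (p \<ominus> a \<otimes> b)"
      using scale[OF eqs(1)] car car2 by (simp add: r_distr minus_eq r_minus)
    have X2: "e \<otimes> y \<oplus> f \<otimes> t = P \<otimes> (a \<otimes> a)"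
      using scale[OF eqs(2)] car car2 by simp
    have X3: "c \<otimes> x \<oplus> i \<otimes> z = \<ominus> (P \<otimes> (b \<otimes> b))"
      using scale[OF eqs(3)] car car2 by (simp add: r_minus)
    have X4: "c \<otimes> y \<oplus> i \<otimes> t = P \<otimes> (p \<oplus> a \<otimes> b)"
      using scale[OF eqs(4)] car car2 by (simp add: r_distr)
    \<comment> \<open>\<open>D\<close> measures the failure of \<open>(a, b)\<close> to be
      proportional to the first column \<open>(e, c)\<close> of \<open>h\<close>. The equations
      \<open>X1\<close> to \<open>X4\<close> make \<open>p\<close> divide
      \<open>x \<otimes> D\<close> and \<open>y \<otimes> D\<close>, and \<open>p\<close> does not
      divide both \<open>x\<close> and \<open>y\<close>.\<close>
    define D where "D = a \<otimes> c \<ominus> b \<otimes> e"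
    have D: "D \<in> S" using ab hS by (simp add: D_def)
    have "x \<otimes> D = a \<otimes> (c \<otimes> x \<oplus> i \<otimes> z) \<ominus> b \<otimes> (e \<otimes> x \<oplus> f \<otimes> z) \<oplus> (b \<otimes> f \<ominus> a \<otimes> i) \<otimes> z"
      unfolding D_def using car car2 by algebra
    also have "\<dots> = p \<otimes> (\<ominus> (P \<otimes> b)) \<oplus> (b \<otimes> f \<ominus> a \<otimes> i) \<otimes> z"
      unfolding X1 X3 using car car2 by algebra
    finally have xD: "u \<otimes> (x \<otimes> D) \<in> S"
      using ab hS xS zt PS by (simp add: dvd_add_cancel dvd_mult_right)
    have "y \<otimes> D = a \<otimes> (c \<otimes> y \<oplus> i \<otimes> t) \<ominus> b \<otimes> (e \<otimes> y \<oplus> f \<otimes> t) \<oplus> (b \<otimes> f \<ominus> a \<otimes> i) \<otimes> t"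
      unfolding D_def using car car2 by algebra
    also have "\<dots> = p \<otimes> (P \<otimes> a) \<oplus> (b \<otimes> f \<ominus> a \<otimes> i) \<otimes> t"
      unfolding X2 X4 using car car2 by algebra
    finally have yD: "u \<otimes> (y \<otimes> D) \<in> S"
      using ab hS xS zt PS by (simp add: dvd_add_cancel dvd_mult_right)
    have "u \<otimes> D \<in> S"
      using xD yD xy prime[OF xS(1) D] prime[OF xS(2) D] by blast
    then show ?thesis using 2(2) unfolding h D_def by blast
  qed
qed

end

section \<open>Proportional columns\<close>

context cring
begin

text \<open>Cramer's rule: the inverse of \<open>Mat2 e f c i\<close> sends the column
  \<open>(a, b)\<close> to \<open>(l, 0)\<close> with
  \<open>l = a \<otimes> i \<ominus> b \<otimes> f\<close>, the second coordinate vanishing by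
  \<open>eq\<close>.\<close>

lemma proportional_unimodular:
  assumes car: "a \<in> carrier R" "b \<in> carrier R" "e \<in> carrier R" "f \<in> carrier R" "c \<in> carrier R" "i \<in> carrier R"
    and det: "e \<otimes> i \<ominus> f \<otimes> c = \<one>" and eq: "a \<otimes> c = b \<otimes> e"
  shows "a = (a \<otimes> i \<ominus> b \<otimes> f) \<otimes> e" "b = (a \<otimes> i \<ominus> b \<otimes> f) \<otimes> c"
proof -
  have "(a \<otimes> i \<ominus> b \<otimes> f) \<otimes> e = a \<otimes> (e \<otimes> i) \<ominus> f \<otimes> (b \<otimes> e)" using car by algebra
  also have "\<dots> = a \<otimes> (e \<otimes> i \<ominus> f \<otimes> c)" unfolding eq[symmetric] using car by algebra
  finally show "a = (a \<otimes> i \<ominus> b \<otimes> f) \<otimes> e" using det car by simp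
  have "(a \<otimes> i \<ominus> b \<otimes> f) \<otimes> c = i \<otimes> (a \<otimes> c) \<ominus> b \<otimes> (f \<otimes> c)" using car by algebra
  also have "\<dots> = b \<otimes> (e \<otimes> i \<ominus> f \<otimes> c)" unfolding eq using car by algebra
  finally show "b = (a \<otimes> i \<ominus> b \<otimes> f) \<otimes> c" using det car by simp
qed

text \<open>The equation \<open>a \<otimes> c = b \<otimes> e\<close> expresses, without division,
  that \<open>(a, b)\<close> is proportional to the image of the first basis vector under an element
  of \<open>G\<close>.\<close>

definition transitive_on_lines :: "'a mat2 set \<Rightarrow> bool" where
  "transitive_on_lines G \<longleftrightarrow> (\<forall>a\<in>carrier R. \<forall>b\<in>carrier R. a \<noteq> \<zero> \<or> b \<noteq> \<zero> \<longrightarrow>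
     (\<exists>e f c i. Mat2 e f c i \<in> G \<and> a \<otimes> c = b \<otimes> e))"

text \<open>Two generators \<open>a\<close>, \<open>b\<close> are multiples of some \<open>l\<close>
  which is itself a combination of them, so \<open>l\<close> generates their ideal. Induction on the
  generating set reduces to this case.\<close>

lemma bezout_if_transitive_on_lines:
  assumes "transitive_on_lines (carrier (SL2 R))"
  shows "bezout_ring R"
proof (intro bezout_ring.intro bezout_ring_axioms.intro is_cring)
  have two: "\<exists>l\<in>carrier R. Idl {a, b} = Idl {l}" if ab: "a \<in> carrier R" "b \<in> carrier R" for a b
  proof (cases "a = \<zero> \<and> b = \<zero>")
    case True
    then show ?thesis by auto
  next
    case False
    then obtain e f c i where g: "Mat2 e f c i \<in> carrier (SL2 R)" "a \<otimes> c = b \<otimes> e"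
      using assms ab unfolding transitive_on_lines_def by blast
    then have car: "e \<in> carrier R" "f \<in> carrier R" "c \<in> carrier R" "i \<in> carrier R"
      and det: "e \<otimes> i \<ominus> f \<otimes> c = \<one>" by (auto simp: mem_SL2)
    define l where "l = a \<otimes> i \<ominus> b \<otimes> f"
    have l: "l \<in> carrier R" using ab car by (simp add: l_def)
    note eq = proportional_unimodular[OF ab car det g(2), folded l_def]
    interpret I: ideal "Idl {a, b}" R by (rule genideal_ideal) (use ab in auto)
    interpret J: ideal "Idl {l}" R by (rule genideal_ideal) (use l in auto)
    have "{a, b} \<subseteq> Idl {a, b}" "{l} \<subseteq> Idl {l}"
      using genideal_self[of "{a, b}"] genideal_self[of "{l}"] ab l by auto
    then have "a \<otimes> i \<in> Idl {a, b}" "\<ominus> (b \<otimes> f) \<in> Idl {a, b}" "l \<otimes> e \<in> Idl {l}" "l \<otimes> c \<in> Idl {l}"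
      using car by (auto intro!: I.I_r_closed J.I_r_closed I.a_inv_closed)
    note mem = this
    have "l \<in> Idl {a, b}" unfolding l_def minus_eq using mem(1,2) by (rule I.a_closed)
    moreover have "a \<in> Idl {l}" by (subst eq(1)) (rule mem)
    moreover have "b \<in> Idl {l}" by (subst eq(2)) (rule mem)
    ultimately have "Idl {a, b} = Idl {l}"
      using genideal_minimal[OF I.is_ideal, of "{l}"] genideal_minimal[OF J.is_ideal, of "{a, b}"] by auto
    with l show ?thesis by blast
  qed
  fix A assume "finite A" "A \<subseteq> carrier R"
  then have "\<exists>l\<in>carrier R. Idl A = Idl {l}"
  proof (induction A rule: finite_induct)
    case empty
    have "Idl {} = Idl {\<zero>}"
      using genideal_minimal[OF zeroideal, of "{}"] genideal_zero
        additive_subgroup.zero_closed[OF ideal.axioms(1)[OF genideal_ideal[of "{}"]]] by auto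
    then show ?case by blast
  next
    case (insert a F)
    then obtain l where l: "l \<in> carrier R" "Idl F = Idl {l}" by auto
    have a: "a \<in> carrier R" and F: "F \<subseteq> carrier R" using insert by auto
    have I: "ideal (Idl (insert a F)) R" "ideal (Idl {a, l}) R"
      using a F l by (auto intro!: genideal_ideal)
    have self: "insert a F \<subseteq> Idl (insert a F)" "{a, l} \<subseteq> Idl {a, l}" "F \<subseteq> Idl F" "l \<in> Idl {l}"
      using genideal_self[of "insert a F"] genideal_self[of "{a, l}"] genideal_self[of F]
        genideal_self'[of l] a F l by auto
    have "Idl F \<subseteq> Idl (insert a F)" "Idl {l} \<subseteq> Idl {a, l}"
      using genideal_minimal[OF I(1), of F] genideal_minimal[OF I(2), of "{l}"] self by auto
    then have "Idl (insert a F) = Idl {a, l}"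
      using self l by (intro equalityI genideal_minimal I) auto
    then show ?case using two[OF a l(1)] by simp
  qed
  then show "principalideal (Idl A) R"
    using principalidealI[OF genideal_ideal] \<open>A \<subseteq> carrier R\<close> by blast
qed

text \<open>Some element of \<open>G\<close> has a first column to which that of the given matrix is
  proportional. The quotient of the two is upper triangular with mutually inverse diagonal entries,
  hence a product of elementary matrices.\<close>

lemma SL2_eq_if_transitive_on_lines:
  assumes nontriv: "\<one> \<noteq> \<zero>"
    and G: "subgroup G (SL2 R)"
    and upper: "\<And>r. r \<in> carrier R \<Longrightarrow> Mat2 \<one> r \<zero> \<one> \<in> G"
    and lower: "\<And>r. r \<in> carrier R \<Longrightarrow> Mat2 \<one> \<zero> r \<one> \<in> G"
    and trans: "transitive_on_lines G"
  shows "G = carrier (SL2 R)"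
proof
  note Gm = subgroup.m_closed[OF G, unfolded SL2_mult]
  show "carrier (SL2 R) \<subseteq> G"
  proof
    fix M assume "M \<in> carrier (SL2 R)"
    then obtain a r b s where M: "M = Mat2 a r b s"
      and car: "a \<in> carrier R" "r \<in> carrier R" "b \<in> carrier R" "s \<in> carrier R"
      and det: "a \<otimes> s \<ominus> r \<otimes> b = \<one>"
      by (cases M) (auto simp: mem_SL2)
    have "a \<noteq> \<zero> \<or> b \<noteq> \<zero>"
      using det nontriv car by (auto simp: minus_eq)
    then obtain e f c i where g: "Mat2 e f c i \<in> G" "a \<otimes> c = b \<otimes> e"
      using trans car unfolding transitive_on_lines_def by blast
    then have car': "e \<in> carrier R" "f \<in> carrier R" "c \<in> carrier R" "i \<in> carrier R"
      and det': "e \<otimes> i \<ominus> f \<otimes> c = \<one>"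
      using subgroup.subset[OF G] by (auto simp: mem_SL2 subset_iff)
    \<comment> \<open>The inverse of \<open>Mat2 e f c i\<close> times \<open>M\<close> has diagonal
      entries \<open>l\<close>, \<open>m\<close> and upper right entry
      \<open>i \<otimes> r \<ominus> f \<otimes> s\<close>; dividing the latter by \<open>l\<close>
      gives \<open>v\<close>.\<close>
    define l where "l = a \<otimes> i \<ominus> b \<otimes> f"
    define m where "m = e \<otimes> s \<ominus> c \<otimes> r"
    define v where "v = m \<otimes> (i \<otimes> r \<ominus> f \<otimes> s)"
    have lmv: "l \<in> carrier R" "m \<in> carrier R" "v \<in> carrier R"
      using car car' by (simp_all add: l_def m_def v_def)
    have eq: "a = l \<otimes> e" "b = l \<otimes> c"
      using proportional_unimodular[OF car(1,3) car' det' g(2)] by (simp_all add: l_def)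
    have "l \<otimes> m = (l \<otimes> e) \<otimes> s \<ominus> r \<otimes> (l \<otimes> c)"
      unfolding m_def using car car' lmv by algebra
    then have lm: "l \<otimes> m = \<one>" using det eq by simp
    then have ml: "m \<otimes> l = \<one>" using lmv by (simp add: m_comm)
    \<comment> \<open>Three elementary matrices produce an antidiagonal one; two antidiagonal ones
      multiply to the diagonal matrix with entries \<open>l\<close>, \<open>m\<close>.\<close>
    have weyl: "mat2_mult R (mat2_mult R (Mat2 \<one> x \<zero> \<one>) (Mat2 \<one> \<zero> (\<ominus> y) \<one>)) (Mat2 \<one> x \<zero> \<one>)
        = Mat2 \<zero> x (\<ominus> y) \<zero>" if "x \<in> carrier R" "y \<in> carrier R" "x \<otimes> y = \<one>" for x y
      using that by (simp add: r_minus l_minus r_neg l_neg m_comm[of y x])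
    have "Mat2 \<zero> x (\<ominus> y) \<zero> \<in> G" if "x \<in> carrier R" "y \<in> carrier R" "x \<otimes> y = \<one>" for x y
      unfolding weyl[OF that, symmetric] using that by (intro Gm upper lower) auto
    from this[OF lmv(1,2) lm] this[of "\<ominus> \<one>" "\<ominus> \<one>"]
    have "mat2_mult R (Mat2 \<zero> l (\<ominus> m) \<zero>) (Mat2 \<zero> (\<ominus> \<one>) \<one> \<zero>) \<in> G"
      by (intro Gm) (simp_all add: l_minus r_minus)
    then have "Mat2 l \<zero> \<zero> m \<in> G" using lmv by (simp add: l_minus r_minus)
    then have "mat2_mult R (Mat2 e f c i) (mat2_mult R (Mat2 l \<zero> \<zero> m) (Mat2 \<one> v \<zero> \<one>)) \<in> G"
      using g(1) upper[OF lmv(3)] by (intro Gm)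
    also have "mat2_mult R (Mat2 e f c i) (mat2_mult R (Mat2 l \<zero> \<zero> m) (Mat2 \<one> v \<zero> \<one>)) = M"
    proof -
      have lv: "l \<otimes> v = i \<otimes> r \<ominus> f \<otimes> s"
        unfolding v_def using lmv car car' lm by (simp add: m_assoc[symmetric])
      have "e \<otimes> (i \<otimes> r \<ominus> f \<otimes> s) \<oplus> f \<otimes> m = r \<otimes> (e \<otimes> i \<ominus> f \<otimes> c)"
        unfolding m_def using car car' by algebra
      moreover have "c \<otimes> (i \<otimes> r \<ominus> f \<otimes> s) \<oplus> i \<otimes> m = s \<otimes> (e \<otimes> i \<ominus> f \<otimes> c)"
        unfolding m_def using car car' by algebra
      moreover have "e \<otimes> l = a" "c \<otimes> l = b" using eq lmv car' by (simp_all add: m_comm)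
      ultimately show ?thesis
        using lmv car car' by (simp add: M lv det')
    qed
    finally show "M \<in> G" .
  qed
qed (rule subgroup.subset[OF G])

end

section \<open>Reduction of matrices along a ring homomorphism\<close>

lemma (in ring_hom_cring) map_mat2_group_hom:
  "group_hom (SL2 R) (SL2 S) (map_mat2 h)"
proof (intro group_hom.intro group_hom_axioms.intro R.SL2_is_group S.SL2_is_group homI)
  fix x assume "x \<in> carrier (SL2 R)"
  then obtain a b c d where x: "x = Mat2 a b c d"
    and car: "a \<in> carrier R" "b \<in> carrier R" "c \<in> carrier R" "d \<in> carrier R"
    and det: "a \<otimes>\<^bsub>R\<^esub> d \<ominus>\<^bsub>R\<^esub> b \<otimes>\<^bsub>R\<^esub> c = \<one>\<^bsub>R\<^esub>"
    by (cases x) (auto simp: R.mem_SL2)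
  have "h a \<otimes>\<^bsub>S\<^esub> h d \<ominus>\<^bsub>S\<^esub> h b \<otimes>\<^bsub>S\<^esub> h c = h (a \<otimes>\<^bsub>R\<^esub> d \<ominus>\<^bsub>R\<^esub> b \<otimes>\<^bsub>R\<^esub> c)"
    using car by (simp add: R.minus_eq S.minus_eq)
  then show "map_mat2 h x \<in> carrier (SL2 S)"
    using car by (simp add: x S.mem_SL2 det)
next
  fix x y assume "x \<in> carrier (SL2 R)" "y \<in> carrier (SL2 R)"
  then show "map_mat2 h (x \<otimes>\<^bsub>SL2 R\<^esub> y) = map_mat2 h x \<otimes>\<^bsub>SL2 S\<^esub> map_mat2 h y"
    by (cases x; cases y) (simp add: R.SL2_mult S.SL2_mult R.mem_SL2)
qed

text \<open>Elementary matrices lift entrywise along a surjective homomorphism, so the image group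
  contains all of them.\<close>

lemma (in ring_hom_cring) SL2_surj_if_transitive_on_lines:
  assumes surj: "h ` carrier R = carrier S" and nontriv: "\<one>\<^bsub>S\<^esub> \<noteq> \<zero>\<^bsub>S\<^esub>"
    and trans: "S.transitive_on_lines (map_mat2 h ` carrier (SL2 R))"
  shows "map_mat2 h ` carrier (SL2 R) = carrier (SL2 S)"
proof (rule S.SL2_eq_if_transitive_on_lines[OF nontriv _ _ _ trans])
  interpret SL2: group_hom "SL2 R" "SL2 S" "map_mat2 h" by (rule map_mat2_group_hom)
  show "subgroup (map_mat2 h ` carrier (SL2 R)) (SL2 S)"
    by (rule SL2.img_is_subgroup)
next
  fix r assume "r \<in> carrier S"
  then obtain t where t: "t \<in> carrier R" "r = h t" using surj by blast
  then have "map_mat2 h (Mat2 \<one> t \<zero> \<one>) = Mat2 \<one>\<^bsub>S\<^esub> r \<zero>\<^bsub>S\<^esub> \<one>\<^bsub>S\<^esub>"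
    "map_mat2 h (Mat2 \<one> \<zero> t \<one>) = Mat2 \<one>\<^bsub>S\<^esub> \<zero>\<^bsub>S\<^esub> r \<one>\<^bsub>S\<^esub>" by simp_all
  then show "Mat2 \<one>\<^bsub>S\<^esub> r \<zero>\<^bsub>S\<^esub> \<one>\<^bsub>S\<^esub> \<in> map_mat2 h ` carrier (SL2 R)"
    "Mat2 \<one>\<^bsub>S\<^esub> \<zero>\<^bsub>S\<^esub> r \<one>\<^bsub>S\<^esub> \<in> map_mat2 h ` carrier (SL2 R)"
    using R.upper_mem_SL2[OF t(1)] R.lower_mem_SL2[OF t(1)] by (metis imageI)+
qed

lemma (in ring_hom_cring) transitive_on_linesI:
  assumes surj: "h ` carrier R = carrier S"
    and lift: "\<And>a b. \<lbrakk> a \<in> carrier R; b \<in> carrier R; h a \<noteq> \<zero>\<^bsub>S\<^esub> \<or> h b \<noteq> \<zero>\<^bsub>S\<^esub> \<rbrakk> \<Longrightarrow>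
      \<exists>e f c i. Mat2 e f c i \<in> carrier (SL2 R) \<and> h (a \<otimes> c \<ominus> b \<otimes> e) = \<zero>\<^bsub>S\<^esub>"
  shows "S.transitive_on_lines (map_mat2 h ` carrier (SL2 R))"
  unfolding S.transitive_on_lines_def
proof (intro ballI impI)
  fix x y assume "x \<in> carrier S" "y \<in> carrier S" and nz: "x \<noteq> \<zero>\<^bsub>S\<^esub> \<or> y \<noteq> \<zero>\<^bsub>S\<^esub>"
  then obtain a b where ab: "a \<in> carrier R" "b \<in> carrier R" and xy: "x = h a" "y = h b"
    unfolding surj[symmetric] by blast
  then obtain e f c i where g: "Mat2 e f c i \<in> carrier (SL2 R)" and eq: "h (a \<otimes> c \<ominus> b \<otimes> e) = \<zero>\<^bsub>S\<^esub>"
    using lift nz by blast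
  have car: "e \<in> carrier R" "f \<in> carrier R" "c \<in> carrier R" "i \<in> carrier R"
    using g by (auto simp: R.mem_SL2)
  have "x \<otimes>\<^bsub>S\<^esub> h c \<ominus>\<^bsub>S\<^esub> y \<otimes>\<^bsub>S\<^esub> h e = \<zero>\<^bsub>S\<^esub>"
    using eq ab car by (simp add: xy)
  then have "x \<otimes>\<^bsub>S\<^esub> h c = y \<otimes>\<^bsub>S\<^esub> h e"
    using ab car xy by (subst (asm) S.r_right_minus_eq) auto
  moreover have "Mat2 (h e) (h f) (h c) (h i) \<in> map_mat2 h ` carrier (SL2 R)"
    using imageI[OF g, of "map_mat2 h"] by simp
  ultimately show "\<exists>e f c i. Mat2 e f c i \<in> map_mat2 h ` carrier (SL2 R) \<and> x \<otimes>\<^bsub>S\<^esub> c = y \<otimes>\<^bsub>S\<^esub> e"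
    by blast
qed

lemma (in ideal) rcos_surj: "(+>) I ` carrier R = carrier (R Quot I)"
  by (auto simp: FactRing_simps)

lemma (in cring) rcos_PIdl_eq_zero_iff:
  assumes "p \<in> carrier R" "a \<in> carrier R"
  shows "PIdl p +> a = \<zero>\<^bsub>R Quot (PIdl p)\<^esub> \<longleftrightarrow> p divides a"
proof -
  interpret I: ideal "PIdl p" R by (rule cgenideal_ideal) fact
  have "PIdl p +> a = \<zero>\<^bsub>R Quot (PIdl p)\<^esub> \<longleftrightarrow> a \<in> PIdl p"
    using I.rcos_const_imp_mem a_rcos_zero[OF I.is_ideal] assms by (auto simp: FactRing_def)
  also have "\<dots> \<longleftrightarrow> p divides a"
    unfolding cgenideal_def factor_def mem_Collect_eq using assms by (metis m_comm)
  finally show ?thesis .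
qed

section \<open>The ring \<open>R[1/p]\<close>\<close>

lemma (in cring) generate_ring_fractions:
  assumes S: "subring S R" and p: "p \<in> S" and u: "u \<in> carrier R" and pu: "p \<otimes> u = \<one>"
    and a: "a \<in> generate_ring R (S \<union> {u})"
  shows "\<exists>s\<in>S. \<exists>n::nat. a = s \<otimes> u [^] n"
proof -
  note SE = subringE[OF S]
  have pc: "p \<in> carrier R" using p SE(1) by blast
  have pow: "p [^] n \<in> S" for n :: nat by (induction n) (simp_all add: SE p)
  have powc: "p [^] n \<in> carrier R" for n :: nat using pc by simp
  \<comment> \<open>Clearing denominators by a power of \<open>p\<close> suits the induction: for
    sums and products the exponents add.\<close>
  have "a \<in> carrier R \<and> (\<exists>n::nat. p [^] n \<otimes> a \<in> S)"
    using a
  proof (induction rule: generate_ring.induct)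
    case one
    have "p [^] (0::nat) \<otimes> \<one> \<in> S" using SE by simp
    then show ?case by blast
  next
    case (incl h)
    then consider "h \<in> S" | "h = u" by blast
    then show ?case
    proof cases
      case 1
      then have "p [^] (0::nat) \<otimes> h \<in> S" "h \<in> carrier R" using SE(1) by auto
      then show ?thesis by blast
    next
      case 2
      have "p [^] (1::nat) \<otimes> h \<in> S" "h \<in> carrier R" using 2 u pu pc SE by auto
      then show ?thesis by blast
    qed
  next
    case (a_inv h)
    then obtain n :: nat where "p [^] n \<otimes> h \<in> S" by blast
    then have "p [^] n \<otimes> (\<ominus> h) \<in> S" using a_inv powc SE by (simp add: r_minus)
    then show ?case using a_inv by blast
  next
    case (eng_add h k)
    then obtain n m :: nat where nm: "p [^] n \<otimes> h \<in> S" "p [^] m \<otimes> k \<in> S" by blast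
    have hk: "h \<in> carrier R" "k \<in> carrier R" using eng_add by auto
    have "p [^] (n + m) \<otimes> (h \<oplus> k) = p [^] m \<otimes> (p [^] n \<otimes> h) \<oplus> p [^] n \<otimes> (p [^] m \<otimes> k)"
      unfolding nat_pow_mult[OF pc, symmetric] using hk powc[of n] powc[of m] by algebra
    then have "p [^] (n + m) \<otimes> (h \<oplus> k) \<in> S" using nm pow by (simp add: SE)
    then show ?case using hk by blast
  next
    case (eng_mult h k)
    then obtain n m :: nat where nm: "p [^] n \<otimes> h \<in> S" "p [^] m \<otimes> k \<in> S" by blast
    have hk: "h \<in> carrier R" "k \<in> carrier R" using eng_mult by auto
    have "p [^] (n + m) \<otimes> (h \<otimes> k) = (p [^] n \<otimes> h) \<otimes> (p [^] m \<otimes> k)"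
      unfolding nat_pow_mult[OF pc, symmetric] using hk powc[of n] powc[of m] by algebra
    then have "p [^] (n + m) \<otimes> (h \<otimes> k) \<in> S" using nm by (simp add: SE)
    then show ?case using hk by blast
  qed
  then obtain n :: nat where n: "p [^] n \<otimes> a \<in> S" and ac: "a \<in> carrier R" by blast
  have "p [^] n \<otimes> u [^] n = \<one>" using pc u pu by (simp add: nat_pow_distrib[symmetric])
  then have "a = (p [^] n \<otimes> u [^] n) \<otimes> a" using ac by simp
  also have "\<dots> = (p [^] n \<otimes> a) \<otimes> u [^] n" using powc[of n] u ac by (simp add: m_ac)
  finally show ?thesis using n by blast
qed

section \<open>The localization inside the field of fractions\<close>

context domain
begin

abbreviation frac_inverse :: "'a \<Rightarrow> ('a \<times> 'a) set" where
  "frac_inverse p \<equiv> inv\<^bsub>fraction_field R\<^esub> (frac_embed R p)"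

lemma frac_inverse:
  assumes "p \<in> carrier R" "p \<noteq> \<zero>"
  shows "frac_inverse p \<in> carrier (fraction_field R)"
    "frac_embed R p \<otimes>\<^bsub>fraction_field R\<^esub> frac_inverse p = \<one>\<^bsub>fraction_field R\<^esub>"
proof -
  interpret K: field "fraction_field R" by (rule fraction_field_is_field)
  interpret E: ring_hom_ring R "fraction_field R" "frac_embed R" by (rule frac_embed_hom)
  have "frac_embed R p \<noteq> \<zero>\<^bsub>fraction_field R\<^esub>"
    using assms inj_onD[OF frac_embed_inj, of p \<zero>] by auto
  then have "frac_embed R p \<in> Units (fraction_field R)"
    using assms by (simp add: K.field_Units)
  then show "frac_inverse p \<in> carrier (fraction_field R)"
    "frac_embed R p \<otimes>\<^bsub>fraction_field R\<^esub> frac_inverse p = \<one>\<^bsub>fraction_field R\<^esub>"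
    by simp_all
qed

text \<open>This translates the membership conditions of \<open>prime_localization\<close> into
  divisibility in the original ring; it rests on injectivity of the embedding.\<close>

lemma frac_inverse_mult_mem:
  assumes p: "p \<in> carrier R" "p \<noteq> \<zero>" and r: "r \<in> carrier R"
  shows "frac_inverse p \<otimes>\<^bsub>fraction_field R\<^esub> frac_embed R r \<in> frac_embed R ` carrier R \<longleftrightarrow> p divides r"
proof -
  interpret K: field "fraction_field R" by (rule fraction_field_is_field)
  interpret E: ring_hom_ring R "fraction_field R" "frac_embed R" by (rule frac_embed_hom)
  note u = frac_inverse[OF p]
  have "frac_inverse p \<otimes>\<^bsub>fraction_field R\<^esub> frac_embed R r = frac_embed R s \<longleftrightarrow> r = p \<otimes> s"
    if s: "s \<in> carrier R" for s
  proof
    assume eq: "frac_inverse p \<otimes>\<^bsub>fraction_field R\<^esub> frac_embed R r = frac_embed R s"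
    have "frac_embed R (p \<otimes> s) = frac_embed R p \<otimes>\<^bsub>fraction_field R\<^esub>
        (frac_inverse p \<otimes>\<^bsub>fraction_field R\<^esub> frac_embed R r)"
      using p s by (simp add: eq)
    also have "\<dots> = frac_embed R r"
      using p r u by (simp add: K.m_assoc[symmetric])
    finally show "r = p \<otimes> s"
      using r p s by (metis frac_embed_inj inj_onD m_closed)
  next
    assume "r = p \<otimes> s"
    then show "frac_inverse p \<otimes>\<^bsub>fraction_field R\<^esub> frac_embed R r = frac_embed R s"
      using p s u K.m_comm[of "frac_embed R p" "frac_inverse p"] by (simp add: K.m_assoc[symmetric])
  qed
  then show ?thesis unfolding factor_def by blast
qed

lemma adjoin_inverse_subring:
  assumes "p \<in> carrier R" "p \<noteq> \<zero>"
  shows "subring (carrier (adjoin_inverse R p)) (fraction_field R)"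
proof -
  interpret K: field "fraction_field R" by (rule fraction_field_is_field)
  interpret E: ring_hom_ring R "fraction_field R" "frac_embed R" by (rule frac_embed_hom)
  show ?thesis
    unfolding adjoin_inverse_def using frac_inverse[OF assms]
    by (simp, intro K.generate_ring_is_subring) auto
qed

lemma adjoin_inverse_cring:
  assumes "p \<in> carrier R" "p \<noteq> \<zero>"
  shows "cring (adjoin_inverse R p)"
proof -
  interpret K: field "fraction_field R" by (rule fraction_field_is_field)
  have "adjoin_inverse R p = (fraction_field R)\<lparr>carrier := carrier (adjoin_inverse R p)\<rparr>"
    by (simp add: adjoin_inverse_def)
  then show ?thesis
    using K.subcringI'[OF adjoin_inverse_subring[OF assms]]
      K.subcring_iff[OF subringE(1)[OF adjoin_inverse_subring[OF assms]]] by simp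
qed

lemma adjoin_inverse_simps [simp]:
  "monoid.mult (adjoin_inverse R p) = monoid.mult (fraction_field R)"
  "ring.add (adjoin_inverse R p) = ring.add (fraction_field R)"
  "monoid.one (adjoin_inverse R p) = monoid.one (fraction_field R)"
  "ring.zero (adjoin_inverse R p) = ring.zero (fraction_field R)"
  by (simp_all add: adjoin_inverse_def)

lemma frac_embed_hom_adjoin_inverse:
  assumes "p \<in> carrier R" "p \<noteq> \<zero>"
  shows "ring_hom_cring R (adjoin_inverse R p) (frac_embed R)"
proof (intro ring_hom_cring.intro ring_hom_cring_axioms.intro adjoin_inverse_cring[OF assms] is_cring ring_hom_memI)
  interpret E: ring_hom_ring R "fraction_field R" "frac_embed R" by (rule frac_embed_hom)
  show "frac_embed R x \<in> carrier (adjoin_inverse R p)" if "x \<in> carrier R" for x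
    using that by (auto simp: adjoin_inverse_def intro: generate_ring.incl)
qed (use ring_hom_memE[OF ring_hom_ring.homh[OF frac_embed_hom]] in simp_all)

lemma adjoin_inverse_localization:
  assumes p: "p \<in> carrier R" "ring_prime p"
  shows "prime_localization (adjoin_inverse R p) (frac_embed R ` carrier R) (frac_embed R p) (frac_inverse p)"
proof -
  let ?K = "fraction_field R" and ?A = "adjoin_inverse R p" and ?S = "frac_embed R ` carrier R"
  have p0: "p \<noteq> \<zero>" and pr: "prime R p" using ring_primeE[OF p] by auto
  interpret K: field ?K by (rule fraction_field_is_field)
  interpret E: ring_hom_cring R ?A "frac_embed R" by (rule frac_embed_hom_adjoin_inverse[OF p(1) p0])
  interpret EK: ring_hom_ring R ?K "frac_embed R" by (rule frac_embed_hom)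
  note mem = frac_inverse_mult_mem[OF p(1) p0]
  have SK: "subring ?S ?K" by (rule EK.img_is_subring[OF carrier_is_subring])
  show ?thesis
  proof (intro prime_localization.intro prime_localization_axioms.intro E.S.is_cring)
    show "subring ?S ?A" by (rule E.ring.img_is_subring[OF carrier_is_subring])
    show "frac_embed R p \<in> ?S" using p by simp
    show "frac_inverse p \<in> carrier ?A"
      by (auto simp: adjoin_inverse_def intro: generate_ring.incl)
    show "frac_embed R p \<otimes>\<^bsub>?A\<^esub> frac_inverse p = \<one>\<^bsub>?A\<^esub>"
      using frac_inverse[OF p(1) p0] by simp
    have "\<not> p divides \<one>"
      using pr p by (auto simp: prime_def Units_def factor_def m_comm)
    then show "frac_inverse p \<notin> ?S"
      using mem[of \<one>] frac_inverse[OF p(1) p0] by simp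
  next
    fix x y assume "x \<in> ?S" "y \<in> ?S" and xy: "frac_inverse p \<otimes>\<^bsub>?A\<^esub> (x \<otimes>\<^bsub>?A\<^esub> y) \<in> ?S"
    then obtain a b where ab: "a \<in> carrier R" "b \<in> carrier R" "x = frac_embed R a" "y = frac_embed R b"
      by blast
    then have "p divides (a \<otimes> b)" using xy mem[of "a \<otimes> b"] by simp
    then have "p divides a \<or> p divides b" using pr ab by (auto simp: prime_def)
    then show "frac_inverse p \<otimes>\<^bsub>?A\<^esub> x \<in> ?S \<or> frac_inverse p \<otimes>\<^bsub>?A\<^esub> y \<in> ?S"
      using ab mem by simp
  next
    fix a assume "a \<in> carrier ?A"
    then have "a \<in> generate_ring ?K (?S \<union> {frac_inverse p})" by (simp add: adjoin_inverse_def)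
    then obtain s and n :: nat where "s \<in> ?S" "a = s \<otimes>\<^bsub>?K\<^esub> frac_inverse p [^]\<^bsub>?K\<^esub> n"
      using K.generate_ring_fractions[OF SK, of "frac_embed R p" "frac_inverse p"]
        frac_inverse[OF p(1) p0] p by blast
    then show "\<exists>s\<in>?S. \<exists>n::nat. a = s \<otimes>\<^bsub>?A\<^esub> frac_inverse p [^]\<^bsub>?A\<^esub> n"
      by (auto simp: nat_pow_def)
  qed
qed

text \<open>The matrix found in the localization has entries in the embedded copy of
  \<open>R\<close>; injectivity brings its determinant condition back to \<open>R\<close>, and
  \<open>frac_inverse_mult_mem\<close> the divisibility.\<close>

lemma column_lift_adjoin_inverse:
  assumes p: "p \<in> carrier R" "ring_prime p"
    and E2: "carrier (SL2 (adjoin_inverse R p)) = E2 (adjoin_inverse R p)"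
    and ab: "a \<in> carrier R" "b \<in> carrier R" "\<not> p divides a \<or> \<not> p divides b"
  shows "\<exists>e f c i. Mat2 e f c i \<in> carrier (SL2 R) \<and> p divides (a \<otimes> c \<ominus> b \<otimes> e)"
proof -
  let ?A = "adjoin_inverse R p" and ?S = "frac_embed R ` carrier R"
  have p0: "p \<noteq> \<zero>" using ring_primeE[OF p] by auto
  interpret E: ring_hom_cring R ?A "frac_embed R" by (rule frac_embed_hom_adjoin_inverse[OF p(1) p0])
  interpret L: prime_localization ?A ?S "frac_embed R p" "frac_inverse p"
    by (rule adjoin_inverse_localization[OF p])
  note mem = frac_inverse_mult_mem[OF p(1) p0]
  have "frac_inverse p \<otimes>\<^bsub>?A\<^esub> frac_embed R a \<notin> ?S \<or> frac_inverse p \<otimes>\<^bsub>?A\<^esub> frac_embed R b \<notin> ?S"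
    using ab mem by simp
  then obtain e' f' c' i' where g: "Mat2 e' f' c' i' \<in> L.stab0"
    and dvd: "frac_inverse p \<otimes>\<^bsub>?A\<^esub> (frac_embed R a \<otimes>\<^bsub>?A\<^esub> c' \<ominus>\<^bsub>?A\<^esub> frac_embed R b \<otimes>\<^bsub>?A\<^esub> e') \<in> ?S"
    using L.column_lift[OF E2, of "frac_embed R a" "frac_embed R b"] ab by blast
  then obtain e f c i where car: "e \<in> carrier R" "f \<in> carrier R" "c \<in> carrier R" "i \<in> carrier R"
    and eq: "e' = frac_embed R e" "f' = frac_embed R f" "c' = frac_embed R c" "i' = frac_embed R i"
    unfolding L.mem_stab0 by blast
  have "frac_embed R (e \<otimes> i \<ominus> f \<otimes> c) = frac_embed R \<one>"
    using g car by (simp add: L.mem_stab0 E.S.mem_SL2 eq del: adjoin_inverse_simps)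
  then have "e \<otimes> i \<ominus> f \<otimes> c = \<one>"
    using car by (intro inj_onD[OF frac_embed_inj]) auto
  moreover have "frac_inverse p \<otimes>\<^bsub>?A\<^esub> frac_embed R (a \<otimes> c \<ominus> b \<otimes> e) \<in> ?S"
    using dvd car ab by (simp add: eq del: adjoin_inverse_simps)
  then have "p divides (a \<otimes> c \<ominus> b \<otimes> e)"
    using mem[of "a \<otimes> c \<ominus> b \<otimes> e"] car ab unfolding adjoin_inverse_simps by simp
  ultimately show ?thesis using car by (auto simp: mem_SL2)
qed

end

theorem theorem1p3:
  fixes R :: "('a, 'm) ring_scheme" (structure) and \<pi> :: 'a
  assumes "domain R"
    and "\<pi> \<in> carrier R" and "ring_prime \<pi>"
    and "(\<Inter>n::nat. PIdl (\<pi> [^] n)) = {\<zero>}"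
    and "\<not> bezout_domain (R Quot (PIdl \<pi>))
       \<or> map_mat2 (\<lambda>r. PIdl \<pi> +> r) ` carrier (SL2 R) \<noteq> carrier (SL2 (R Quot (PIdl \<pi>)))"
  shows "carrier (SL2 (adjoin_inverse R \<pi>)) \<noteq> E2 (adjoin_inverse R \<pi>)"
proof
  assume E2: "carrier (SL2 (adjoin_inverse R \<pi>)) = E2 (adjoin_inverse R \<pi>)"
  let ?I = "PIdl \<pi>"
  let ?Q = "R Quot ?I"
  interpret domain R by fact
  have "\<pi> \<noteq> \<zero>" by (rule ring_primeE(1)[OF assms(2,3)])
  then have I: "primeideal ?I R"
    using primeideal_iff_prime[of \<pi>] assms(2,3) by blast
  then have ideal: "ideal ?I R" by (rule primeideal.axioms)
  have Q: "domain ?Q" by (rule primeideal.quotient_is_domain[OF I])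
  then have cring_Q: "cring ?Q" by (rule domain.axioms)
  have h: "ring_hom_cring R ?Q ((+>) ?I)" by (rule primeideal.rcos_ring_hom_cring[OF I])
  \<comment> \<open>This one fact refutes both alternatives of the last hypothesis: surjectivity
    follows from it, and then the Bezout property.\<close>
  have "cring.transitive_on_lines ?Q (map_mat2 ((+>) ?I) ` carrier (SL2 R))"
  proof (rule ring_hom_cring.transitive_on_linesI[OF h ideal.rcos_surj[OF ideal]])
    fix a b assume ab: "a \<in> carrier R" "b \<in> carrier R"
      and nz: "?I +> a \<noteq> \<zero>\<^bsub>?Q\<^esub> \<or> ?I +> b \<noteq> \<zero>\<^bsub>?Q\<^esub>"
    have "\<not> \<pi> divides a \<or> \<not> \<pi> divides b"
      using nz rcos_PIdl_eq_zero_iff[OF assms(2)] ab by blast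
    then obtain e f c i where g: "Mat2 e f c i \<in> carrier (SL2 R)" "\<pi> divides (a \<otimes> c \<ominus> b \<otimes> e)"
      using column_lift_adjoin_inverse[OF assms(2,3) E2 ab] by blast
    then have "a \<otimes> c \<ominus> b \<otimes> e \<in> carrier R" using ab by (simp add: mem_SL2)
    then have "?I +> (a \<otimes> c \<ominus> b \<otimes> e) = \<zero>\<^bsub>?Q\<^esub>"
      using rcos_PIdl_eq_zero_iff[OF assms(2)] g(2) by blast
    with g(1) show "\<exists>e f c i. Mat2 e f c i \<in> carrier (SL2 R) \<and> ?I +> (a \<otimes> c \<ominus> b \<otimes> e) = \<zero>\<^bsub>?Q\<^esub>"
      by blast
  qed
  note trans = this
  have eq: "map_mat2 ((+>) ?I) ` carrier (SL2 R) = carrier (SL2 ?Q)"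
    by (rule ring_hom_cring.SL2_surj_if_transitive_on_lines[OF h ideal.rcos_surj[OF ideal]
          domain.one_not_zero[OF Q] trans])
  \<comment> \<open>By surjectivity, transitivity of the image is transitivity of the full group
    over the quotient.\<close>
  have "bezout_ring ?Q"
    by (rule cring.bezout_if_transitive_on_lines[OF cring_Q trans[unfolded eq]])
  then have "bezout_domain ?Q" by (intro bezout_domain.intro Q)
  with eq assms(5) show False by blast
qed

end
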